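(* There exists an $O(k5^k)$-approximation algorithm for the unweighted $(k,m)$-CDS problem in unit disk graphs if $m\ge k$. That is, there are a universal constant $C$ and a polynomial-time algorithm which, given a unit disk graph $G=(V,E)$ and positive integers $k,m$ with $m\ge k$ such that $G$ has a $(k,m)$-CDS, outputs a $(k,m)$-CDS of $G$ of cardinality at most $C\,k\,5^k\cdot \mathrm{OPT}$, where $\mathrm{OPT}$ is the minimum cardinality of a $(k,m)$-CDS of $G$.
   Context: Graphs are finite, undirected and simple. In a unit disk graph, each node is placed at a point of the Euclidean plane, and two nodes are joined by an edge if and only if their distance is at most a unit length. For $S\subseteq V$, $G[S]$ is the subgraph induced by $S$. A graph is $k$-connected if it is connected even when any $k-1$ or fewer nodes are removed; by convention a complete graph on at most $k$ nodes is $k$-connected. A set $S\subseteq V$ is $k$-connected if $G[S]$ is $k$-connected, and $m$-dominating if every node of $V\setminus S$ has at least $m$ neighbors in $S$. A $(k,m)$-CDS is a set $S\subseteq V$ that is $k$-connected and $m$-dominating. The unweighted $(k,m)$-CDS problem asks for a $(k,m)$-CDS of minimum cardinality. *)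

theory Defs
  imports
    "HOL-Analysis.Analysis"
    "HOL-Computational_Algebra.Polynomial"
    "Graph_Theory.Graph_Theory"
begin

section \<open>Graphs\<close>

text \<open>
  A finite simple undirected graph is a \<open>pair_graph\<close>: a finite, loop-free, symmetric set of arcs.
\<close>

definition unit_disk_graph :: "'a pair_pre_digraph \<Rightarrow> bool" where
  "unit_disk_graph G \<longleftrightarrow> pair_graph G \<and>
     (\<exists>pos :: 'a \<Rightarrow> real ^ 2. \<forall>u \<in> pverts G. \<forall>v \<in> pverts G.
        u \<noteq> v \<longrightarrow> ((u, v) \<in> parcs G \<longleftrightarrow> dist (pos u) (pos v) \<le> 1))"

text \<open>
  The null graph is not \<open>connected\<close>, so the first disjunct alone would reject complete
  graphs on fewer than \<open>k\<close> nodes; the convention about small complete graphs is the second one.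
\<close>

definition k_connected :: "nat \<Rightarrow> ('a, 'b) pre_digraph \<Rightarrow> bool" where
  "k_connected k H \<longleftrightarrow>
     (\<forall>X. X \<subseteq> verts H \<and> finite X \<and> card X < k \<longrightarrow> Digraph_Component.connected (H \<restriction> (verts H - X))) \<or>
     (\<exists>n \<le> k. complete_digraph n H)"

definition m_dominating :: "nat \<Rightarrow> ('a, 'b) pre_digraph \<Rightarrow> 'a set \<Rightarrow> bool" where
  "m_dominating m G S \<longleftrightarrow> (\<forall>v \<in> verts G - S. m \<le> card {u \<in> S. v \<rightarrow>\<^bsub>G\<^esub> u})"

definition is_km_CDS :: "('a, 'b) pre_digraph \<Rightarrow> nat \<Rightarrow> nat \<Rightarrow> 'a set \<Rightarrow> bool" where
  "is_km_CDS G k m S \<longleftrightarrow> S \<subseteq> verts G \<and> k_connected k (G \<restriction> S) \<and> m_dominating m G S"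

definition opt_km_CDS :: "('a, 'b) pre_digraph \<Rightarrow> nat \<Rightarrow> nat \<Rightarrow> nat" where
  "opt_km_CDS G k m = Min (card ` {S. is_km_CDS G k m S})"


section \<open>Algorithms and their running time\<close>

text \<open>
  Algorithms are programs of the language WHILE of N. D. Jones (Computability and Complexity
  from a Programming Perspective, 1997): imperative programs whose only data are binary trees
  with a single kind of leaf. Jones shows that its polynomial-time programs compute exactly
  what polynomial-time Turing machines compute.
\<close>

datatype btree = Leaf | Node btree btree

fun left :: "btree \<Rightarrow> btree" where
  "left Leaf = Leaf"
| "left (Node a b) = a"

fun right :: "btree \<Rightarrow> btree" where
  "right Leaf = Leaf"
| "right (Node a b) = b"

text \<open>The number of all nodes, leaves included (the automatic \<open>size\<close> does not count leaves).\<close>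

fun tsize :: "btree \<Rightarrow> nat" where
  "tsize Leaf = 1"
| "tsize (Node a b) = 1 + tsize a + tsize b"

datatype expr = EVar nat | ELeaf | ENode expr expr | ELeft expr | ERight expr

type_synonym store = "nat \<Rightarrow> btree"

fun eval :: "expr \<Rightarrow> store \<Rightarrow> btree" where
  "eval (EVar x) s = s x"
| "eval ELeaf s = Leaf"
| "eval (ENode e f) s = Node (eval e s) (eval f s)"
| "eval (ELeft e) s = left (eval e s)"
| "eval (ERight e) s = right (eval e s)"

text \<open>
  Every operation is charged the full size of the tree it yields, as if that tree were written
  out afresh. Unlike with unit costs, no tree larger than the elapsed time can ever be built.
\<close>

fun eval_cost :: "expr \<Rightarrow> store \<Rightarrow> nat" where
  "eval_cost (EVar x) s = tsize (s x)"
| "eval_cost ELeaf s = 1"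
| "eval_cost (ENode e f) s = eval_cost e s + eval_cost f s + tsize (eval (ENode e f) s)"
| "eval_cost (ELeft e) s = eval_cost e s + tsize (eval (ELeft e) s)"
| "eval_cost (ERight e) s = eval_cost e s + tsize (eval (ERight e) s)"

datatype com =
    Skip
  | Assign nat expr
  | Seq com com
  | Cond expr com com
  | While expr com

text \<open>
  \<open>exec c s t s'\<close>: started in store \<open>s\<close>, command \<open>c\<close> halts in store \<open>s'\<close> after time \<open>t\<close>.
  Tests regard \<open>Leaf\<close> as false and every other tree as true.
\<close>

inductive exec :: "com \<Rightarrow> store \<Rightarrow> nat \<Rightarrow> store \<Rightarrow> bool" where
  Skip: "exec Skip s 1 s"
| Assign: "exec (Assign x e) s (1 + eval_cost e s) (s(x := eval e s))"
| Seq: "exec c s t s' \<Longrightarrow> exec d s' t' s'' \<Longrightarrow> exec (Seq c d) s (1 + t + t') s''"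
| CondTrue: "eval e s \<noteq> Leaf \<Longrightarrow> exec c s t s' \<Longrightarrow>
    exec (Cond e c d) s (1 + eval_cost e s + t) s'"
| CondFalse: "eval e s = Leaf \<Longrightarrow> exec d s t s' \<Longrightarrow>
    exec (Cond e c d) s (1 + eval_cost e s + t) s'"
| WhileFalse: "eval e s = Leaf \<Longrightarrow> exec (While e c) s (1 + eval_cost e s) s"
| WhileTrue: "eval e s \<noteq> Leaf \<Longrightarrow> exec c s t s' \<Longrightarrow> exec (While e c) s' t' s'' \<Longrightarrow>
    exec (While e c) s (1 + eval_cost e s + t + t') s''"

inductive_cases SkipE: "exec Skip s t s'"
inductive_cases AssignE: "exec (Assign x e) s t s'"
inductive_cases SeqE: "exec (Seq c d) s t s'"
inductive_cases CondE: "exec (Cond e c d) s t s'"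
inductive_cases WhileE: "exec (While e c) s t s'"

lemma exec_deterministic:
  "exec c s t s' \<Longrightarrow> exec c s u s'' \<Longrightarrow> u = t \<and> s'' = s'"
proof (induction arbitrary: u s'' rule: exec.induct)
  case (Skip s)
  from Skip.prems show ?case by (rule SkipE) simp
next
  case (Assign x e s)
  from Assign.prems show ?case by (rule AssignE) simp
next
  case (Seq c s t s' d t' s2)
  from Seq.prems show ?case
  proof (rule SeqE)
    fix v r v'
    assume *: "u = Suc (v + v')" "exec c s v r" "exec d r v' s''"
    from Seq.IH(1)[OF *(2)] *(3) have "exec d s' v' s''" by simp
    from Seq.IH(2)[OF this] Seq.IH(1)[OF *(2)] *(1) show ?thesis by simp
  qed
next
  case (CondTrue e s c t s' d)
  from CondTrue.prems show ?case
  proof (rule CondE)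
    fix v
    assume *: "u = Suc (eval_cost e s + v)" "exec c s v s''"
    from CondTrue.IH[OF *(2)] *(1) show ?thesis by simp
  next
    assume "eval e s = Leaf"
    with CondTrue.hyps show ?thesis by simp
  qed
next
  case (CondFalse e s d t s' c)
  from CondFalse.prems show ?case
  proof (rule CondE)
    fix v
    assume *: "u = Suc (eval_cost e s + v)" "exec d s v s''"
    from CondFalse.IH[OF *(2)] *(1) show ?thesis by simp
  next
    assume "eval e s \<noteq> Leaf"
    with CondFalse.hyps show ?thesis by simp
  qed
next
  case (WhileFalse e s c)
  from WhileFalse.prems show ?case
  proof (rule WhileE)
    assume "u = Suc (eval_cost e s)" "s'' = s"
    then show ?thesis by simp
  next
    assume "eval e s \<noteq> Leaf"
    with WhileFalse.hyps show ?thesis by simp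
  qed
next
  case (WhileTrue e s c t s' t' s2)
  from WhileTrue.prems show ?case
  proof (rule WhileE)
    assume "eval e s = Leaf"
    with WhileTrue.hyps show ?thesis by simp
  next
    fix v r v'
    assume *: "u = Suc (eval_cost e s + v + v')" "exec c s v r" "exec (While e c) r v' s''"
    from WhileTrue.IH(1)[OF *(2)] *(3) have "exec (While e c) s' v' s''" by simp
    from WhileTrue.IH(2)[OF this] WhileTrue.IH(1)[OF *(2)] *(1) show ?thesis by simp
  qed
qed

text \<open>Input and output are held by variable 0; all other variables are initially \<open>Leaf\<close>.\<close>

definition computes :: "com \<Rightarrow> btree \<Rightarrow> btree \<Rightarrow> nat \<Rightarrow> bool" where
  "computes P x y t \<longleftrightarrow> (\<exists>s. exec P ((\<lambda>_. Leaf)(0 := x)) t s \<and> s 0 = y)"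


section \<open>Encoding of instances and solutions\<close>

fun enc_list :: "btree list \<Rightarrow> btree" where
  "enc_list [] = Leaf"
| "enc_list (a # as) = Node a (enc_list as)"

definition enc_bool :: "bool \<Rightarrow> btree" where
  "enc_bool b = (if b then Node Leaf Leaf else Leaf)"

fun binary :: "nat \<Rightarrow> bool list" where
  "binary n = (if n = 0 then [] else odd n # binary (n div 2))"

declare binary.simps [simp del]

definition enc_nat :: "nat \<Rightarrow> btree" where
  "enc_nat n = enc_list (map enc_bool (binary n))"

text \<open>
  An enumeration \<open>vs\<close> of the nodes fixes the order of the rows and columns of the adjacency
  matrix, and of the 0/1 vectors that represent node sets.
\<close>

definition enc_graph :: "'a list \<Rightarrow> 'a pair_pre_digraph \<Rightarrow> btree" where
  "enc_graph vs G = enc_list (map (\<lambda>u. enc_list (map (\<lambda>v. enc_bool ((u, v) \<in> parcs G)) vs)) vs)"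

definition enc_instance :: "'a list \<Rightarrow> 'a pair_pre_digraph \<Rightarrow> nat \<Rightarrow> nat \<Rightarrow> btree" where
  "enc_instance vs G k m = enc_list [enc_graph vs G, enc_nat k, enc_nat m]"

definition enc_set :: "'a list \<Rightarrow> 'a set \<Rightarrow> btree" where
  "enc_set vs S = enc_list (map (\<lambda>v. enc_bool (v \<in> S)) vs)"

end

theory Submission
  imports Defs
begin

text \<open>
  Scanning the nodes and keeping a node whenever fewer than \<open>c\<close> of its neighbours were kept gives a
  \<open>c\<close>-dominating set \<open>D\<^sub>c\<close> meeting every clique in at most \<open>c\<close> nodes. Cutting the plane into cells
  of diameter less than 1, which are cliques, there are \<open>O(c)\<close> nodes of \<open>D\<^sub>c\<close> within constant distance
  of any node, and double counting gives \<open>|D\<^sub>c| = O(|T|)\<close> for every \<open>c\<close>-dominating set \<open>T\<close>. For any two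
  nodes \<open>u\<close>, \<open>v\<close> of \<open>D\<^sub>k\<close>, keep \<open>O(k\<^sup>2)\<close> of the paths \<open>u, a, b, v\<close> such that fewer than \<open>k\<close> faults
  destroying all kept paths destroy all paths. The whole node set is \<open>k\<close>-connected because a feasible
  solution exists; after deleting fewer than \<open>k\<close> nodes, every node still has a neighbour in \<open>D\<^sub>k\<close>,
  so that walks can be rerouted through \<open>D\<^sub>k\<close> and the kept paths. Together with \<open>D\<^sub>m\<close> this is a
  \<open>(k, m)\<close>-CDS of size \<open>O(k\<^sup>3) OPT\<close>, and \<open>k\<^sup>2 \<le> 5\<^sup>k\<close>.
\<close>

text \<open>The parameter \<open>k\<close> is part of the input, so fault sets cannot be enumerated.
  Faults sparing \<open>u\<close> and \<open>v\<close> destroy all paths \<open>u, a, b, v\<close>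
  exactly when they form a vertex cover of the pairs \<open>(a, b)\<close>. As in the kernel for
  small vertex covers, a cap of \<open>k\<close> kept pairs per first node and per second node and a
  cap of \<open>2 * k * k\<close> in total lose no information about covers with fewer than
  \<open>k\<close> nodes. Two inner nodes suffice because every node of a walk is, after the faults,
  in \<open>D\<^sub>k\<close> or adjacent to a node of it. The positions are not part of the input:
  the program sees an adjacency matrix only, and geometry enters the size estimate alone. The
  numbers \<open>k\<close> and \<open>m\<close> arrive in binary and may be exponentially large, so
  they are capped at the number of nodes. The program is not written down explicitly. Closure
  properties of polynomial-time computability produce it, and every loop rule asks for a bound on
  the intermediate values. The convention on small complete graphs matters only when
  \<open>D\<^sub>k\<close> is the whole node set, which is then the output.\<close>

section \<open>Polynomial-time computable functions\<close>

text \<open>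
  \<open>runs P n x y b\<close>: with \<open>x\<close> in variable \<open>n\<close> and arbitrary contents elsewhere, \<open>P\<close> replaces
  \<open>x\<close> by \<open>y\<close> within time \<open>b\<close>. Variables below \<open>n\<close> are preserved and those above are scratch
  space, so that programs can be combined without renaming.
\<close>

definition runs :: "com \<Rightarrow> nat \<Rightarrow> btree \<Rightarrow> btree \<Rightarrow> nat \<Rightarrow> bool" where
  "runs P n x y b \<longleftrightarrow> (\<forall>s. s n = x \<longrightarrow>
     (\<exists>t s'. exec P s t s' \<and> s' n = y \<and> (\<forall>j<n. s' j = s j) \<and> t \<le> b))"

text \<open>
  A single program has to map \<open>e i\<close> to \<open>g i\<close> for all \<open>i\<close>: here \<open>i\<close> ranges over the abstract
  values of all program variables in scope, and \<open>e\<close> encodes them.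
\<close>

definition ptime :: "('i \<Rightarrow> btree) \<Rightarrow> ('i \<Rightarrow> btree) \<Rightarrow> bool" where
  "ptime e g \<longleftrightarrow> (\<exists>p :: nat poly. \<forall>n. \<exists>P. \<forall>i. runs P n (e i) (g i) (poly p (tsize (e i))))"

lemma poly_nat_mono: "x \<le> y \<Longrightarrow> poly p x \<le> poly p y" for p :: "nat poly"
  by (induction p) (auto intro!: add_mono mult_mono)

lemma tsize_eval: "tsize (eval e s) \<le> eval_cost e s"
  by (cases e) auto

text \<open>An assignment is charged the size of the tree it stores, so the growth of any variable
  is paid for by the elapsed time.\<close>

lemma tsize_exec: "exec c s t s' \<Longrightarrow> tsize (s' x) \<le> tsize (s x) + t"
proof (induction arbitrary: x rule: exec.induct)
  case (Assign y e s)
  then show ?case using tsize_eval[of e s] by auto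
next
  case (Seq c s t s' d t' s'')
  show ?case using Seq.IH(1)[of x] Seq.IH(2)[of x] by linarith
next
  case (CondTrue e s c t s' d)
  show ?case using CondTrue.IH[of x] by linarith
next
  case (CondFalse e s d t s' c)
  show ?case using CondFalse.IH[of x] by linarith
next
  case (WhileTrue e s c t s' t' s'')
  show ?case using WhileTrue.IH(1)[of x] WhileTrue.IH(2)[of x] by linarith
qed auto

lemma tsize_pos [simp]: "0 < tsize x"
  by (cases x) auto

lemma tsize_left [simp]: "tsize (left x) \<le> tsize x"
  and tsize_right [simp]: "tsize (right x) \<le> tsize x"
  by (cases x; simp)+

lemma runsI:
  assumes "\<And>s. s n = x \<Longrightarrow> \<exists>t s'. exec P s t s' \<and> s' n = y \<and> (\<forall>j<n. s' j = s j) \<and> t \<le> b"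
  shows "runs P n x y b"
  using assms by (auto simp: runs_def)

lemma runsD:
  "runs P n x y b \<Longrightarrow> s n = x \<Longrightarrow> \<exists>t s'. exec P s t s' \<and> s' n = y \<and> (\<forall>j<n. s' j = s j) \<and> t \<le> b"
  by (auto simp: runs_def)

lemma runs_mono: "runs P n x y b \<Longrightarrow> b \<le> c \<Longrightarrow> runs P n x y c"
  unfolding runs_def using order_trans by blast

lemma runs_Assign:
  "(\<And>s. s n = x \<Longrightarrow> eval e s = y \<and> eval_cost e s \<le> b) \<Longrightarrow> runs (Assign n e) n x y (1 + b)"
  by (intro runsI exI conjI) (rule exec.Assign, auto)

lemma runs_Seq:
  assumes P: "runs P n x y b" and Q: "runs Q n y z c"
  shows "runs (Seq P Q) n x z (1 + b + c)"
proof (rule runsI)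
  fix s :: store assume "s n = x"
  then obtain t s' where 1: "exec P s t s'" "s' n = y" "\<forall>j<n. s' j = s j" "t \<le> b"
    using P by (auto simp: runs_def)
  then obtain t' s'' where 2: "exec Q s' t' s''" "s'' n = z" "\<forall>j<n. s'' j = s' j" "t' \<le> c"
    using Q by (auto simp: runs_def)
  show "\<exists>t s'. exec (Seq P Q) s t s' \<and> s' n = z \<and> (\<forall>j<n. s' j = s j) \<and> t \<le> 1 + b + c"
    using exec.Seq[OF 1(1) 2(1)] 1 2 by (intro exI[of _ "1+t+t'"] exI[of _ s'']) auto
qed

text \<open>A subroutine call: the argument is copied from \<open>n\<close> to \<open>j\<close>, and
  a program written for base \<open>j\<close> runs there. If \<open>n < j\<close>, the original
  argument survives, since variables below \<open>j\<close> are preserved.\<close>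

lemma runs_call:
  assumes "runs P j x y b" "s n = x"
  obtains t s' where "exec (Seq (Assign j (EVar n)) P) s t s'" "s' j = y" "\<forall>i<j. s' i = s i"
    "t \<le> 3 + tsize x + b"
proof -
  obtain t s' where 1: "exec P (s(j := x)) t s'" "s' j = y" "\<forall>i<j. s' i = (s(j := x)) i" "t \<le> b"
    using assms by (metis runs_def fun_upd_same)
  have "exec (Assign j (EVar n)) s (1 + tsize x) (s(j := x))"
    using exec.Assign[of j "EVar n" s] assms by simp
  from that[OF exec.Seq[OF this 1(1)]] 1 show thesis by auto
qed

section \<open>Closure under composition, projections, pairing and branching\<close>

lemma ptimeE:
  assumes "ptime e g"
  obtains p :: "nat poly" where "\<And>n. \<exists>P. \<forall>i. runs P n (e i) (g i) (poly p (tsize (e i)))"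
  using assms by (auto simp: ptime_def)

text \<open>The output is written within the running time, so a time polynomial also bounds its
  size; \<open>[:0, 1:]\<close> pays for the initial contents of the variable.\<close>

lemma ptime_tsize:
  assumes "ptime e g"
  obtains p :: "nat poly" where "\<And>i. tsize (g i) \<le> poly p (tsize (e i))"
proof -
  obtain p :: "nat poly" where "\<And>n. \<exists>P. \<forall>i. runs P n (e i) (g i) (poly p (tsize (e i)))"
    using assms by (rule ptimeE) blast
  then obtain P where P: "\<And>i. runs P 0 (e i) (g i) (poly p (tsize (e i)))" by blast
  have "tsize (g i) \<le> poly ([:0, 1:] + p) (tsize (e i))" for i
  proof -
    obtain t s' where *: "exec P (\<lambda>_. e i) t s'" "s' 0 = g i" "t \<le> poly p (tsize (e i))"
      using P[of i] unfolding runs_def by force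
    then show ?thesis using tsize_exec[OF *(1), of 0] by simp
  qed
  then show thesis by (rule that)
qed

lemma ptime_reindex: "ptime e g \<Longrightarrow> ptime (\<lambda>j. e (h j)) (\<lambda>j. g (h j))"
  unfolding ptime_def by blast

lemma ptime_id: "ptime e e"
proof -
  have "runs Skip n (e i) (e i) (poly [:1:] (tsize (e i)))" for n i
    by (intro runsI exI conjI) (rule exec.Skip, auto)
  then show ?thesis unfolding ptime_def by blast
qed

text \<open>The intermediate value \<open>f i\<close> itself serves as the encoding of
  \<open>i\<close> for the second program. Its time is polynomial in \<open>tsize (f i)\<close>,
  hence at most \<open>pcompose q r\<close> of the input size, as polynomials over the naturals are
  monotone.\<close>

lemma ptime_comp:
  assumes "ptime e f" "ptime f g"
  shows "ptime e g"
proof -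
  obtain p :: "nat poly" where p: "\<And>n. \<exists>P. \<forall>i. runs P n (e i) (f i) (poly p (tsize (e i)))"
    using assms(1) by (rule ptimeE) blast
  obtain q :: "nat poly" where q: "\<And>n. \<exists>P. \<forall>i. runs P n (f i) (g i) (poly q (tsize (f i)))"
    using assms(2) by (rule ptimeE) blast
  obtain r :: "nat poly" where r: "\<And>i. tsize (f i) \<le> poly r (tsize (e i))"
    using assms(1) by (rule ptime_tsize) blast
  show ?thesis unfolding ptime_def
  proof (intro exI[of _ "1 + p + pcompose q r"] allI)
    fix n
    obtain P Q where P: "\<And>i. runs P n (e i) (f i) (poly p (tsize (e i)))"
      and Q: "\<And>i. runs Q n (f i) (g i) (poly q (tsize (f i)))" using p[of n] q[of n] by blast
    have "runs (Seq P Q) n (e i) (g i) (poly (1 + p + pcompose q r) (tsize (e i)))" for i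
      by (rule runs_mono[OF runs_Seq[OF P Q]]) (simp add: poly_pcompose poly_nat_mono r)
    then show "\<exists>P. \<forall>i. runs P n (e i) (g i) (poly (1 + p + pcompose q r) (tsize (e i)))" by blast
  qed
qed

lemma ptime_assign:
  fixes p :: "nat poly"
  assumes "\<And>n i s. s n = e i \<Longrightarrow> eval (c n) s = g i \<and> eval_cost (c n) s \<le> poly p (tsize (e i))"
  shows "ptime e g"
proof -
  have "runs (Assign n (c n)) n (e i) (g i) (poly (1 + p) (tsize (e i)))" for n i
    using runs_Assign[of n "e i" "c n" "g i"] assms by simp
  then show ?thesis unfolding ptime_def by blast
qed

lemma ptime_Leaf: "ptime e (\<lambda>_. Leaf)"
  by (rule ptime_assign[where c = "\<lambda>_. ELeaf" and p = 1]) auto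

lemma ptime_left: "ptime e f \<Longrightarrow> ptime e (\<lambda>i. left (f i))"
  by (erule ptime_comp, rule ptime_assign[where c = "\<lambda>n. ELeft (EVar n)" and p = "[:0, 2:]"])
     (auto simp: mult_2_right)

lemma ptime_right: "ptime e f \<Longrightarrow> ptime e (\<lambda>i. right (f i))"
  by (erule ptime_comp, rule ptime_assign[where c = "\<lambda>n. ERight (EVar n)" and p = "[:0, 2:]"])
     (auto simp: mult_2_right)

text \<open>Both components read the same input, so each is a call on a copy: the first at base
  \<open>n+1\<close>, the second at base \<open>n+2\<close>, where it cannot disturb the first
  result.\<close>

lemma ptime_Node:
  assumes "ptime e f" "ptime e g"
  shows "ptime e (\<lambda>i. Node (f i) (g i))"
proof -
  obtain p :: "nat poly" where p: "\<And>n. \<exists>P. \<forall>i. runs P n (e i) (f i) (poly p (tsize (e i)))"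
    using assms(1) by (rule ptimeE) blast
  obtain q :: "nat poly" where q: "\<And>n. \<exists>P. \<forall>i. runs P n (e i) (g i) (poly q (tsize (e i)))"
    using assms(2) by (rule ptimeE) blast
  obtain r :: "nat poly" where r: "\<And>i. tsize (f i) \<le> poly r (tsize (e i))"
    using assms(1) by (rule ptime_tsize) blast
  obtain r' :: "nat poly" where r': "\<And>i. tsize (g i) \<le> poly r' (tsize (e i))"
    using assms(2) by (rule ptime_tsize) blast
  let ?b = "[:10, 2:] + p + q + [:2:] * r + [:2:] * r'"
  show ?thesis unfolding ptime_def
  proof (intro exI[of _ "?b"] allI)
    fix n
    obtain P Q where P: "\<And>i. runs P (n+1) (e i) (f i) (poly p (tsize (e i)))"
      and Q: "\<And>i. runs Q (n+2) (e i) (g i) (poly q (tsize (e i)))"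
      using p[of "n+1"] q[of "n+2"] by blast
    let ?A = "Seq (Assign (n+1) (EVar n)) P" and ?B = "Seq (Assign (n+2) (EVar n)) Q"
      and ?C = "Assign n (ENode (EVar (n+1)) (EVar (n+2)))"
    have "runs (Seq ?A (Seq ?B ?C)) n (e i) (Node (f i) (g i)) (poly ?b (tsize (e i)))" for i
    proof (rule runsI)
      fix s :: store assume s: "s n = e i"
      obtain t s1 where 1: "exec ?A s t s1" "s1 (n+1) = f i" "\<forall>i<n+1. s1 i = s i"
        "t \<le> 3 + tsize (e i) + poly p (tsize (e i))"
        using runs_call[where s = s and n = n, OF P[of i] s] by blast
      have s1: "s1 n = e i" using 1 s by simp
      obtain t' s2 where 2: "exec ?B s1 t' s2" "s2 (n+2) = g i" "\<forall>i<n+2. s2 i = s1 i"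
        "t' \<le> 3 + tsize (e i) + poly q (tsize (e i))"
        using runs_call[where s = s1 and n = n, OF Q[of i] s1] by blast
      have 3: "exec ?C s2 (1 + eval_cost (ENode (EVar (n+1)) (EVar (n+2))) s2) (s2(n := Node (f i) (g i)))"
        using exec.Assign[of n "ENode (EVar (n+1)) (EVar (n+2))" s2] 1 2 by simp
      have "eval_cost (ENode (EVar (n+1)) (EVar (n+2))) s2 = 1 + 2 * tsize (f i) + 2 * tsize (g i)"
        using 1 2 by simp
      then show "\<exists>t s'. exec (Seq ?A (Seq ?B ?C)) s t s' \<and> s' n = Node (f i) (g i) \<and>
          (\<forall>j<n. s' j = s j) \<and> t \<le> poly ?b (tsize (e i))"
        using 1(2-4) 2(2-4) r[of i] r'[of i]
        by - (intro exI conjI, rule exec.Seq[OF 1(1) exec.Seq[OF 2(1) 3]], auto simp: algebra_simps)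
    qed
    then show "\<exists>P. \<forall>i. runs P n (e i) (Node (f i) (g i)) (poly ?b (tsize (e i)))" by blast
  qed
qed

lemma ptime_fst: "ptime h (\<lambda>i. Node (f i) (g i)) \<Longrightarrow> ptime h f"
  using ptime_left by fastforce

lemma ptime_snd: "ptime h (\<lambda>i. Node (f i) (g i)) \<Longrightarrow> ptime h g"
  using ptime_right by fastforce

lemma ptime_if_Leaf:
  assumes "ptime e c" "ptime e f" "ptime e g"
  shows "ptime e (\<lambda>i. if c i \<noteq> Leaf then f i else g i)"
proof -
  obtain p0 :: "nat poly" where p0: "\<And>n. \<exists>P. \<forall>i. runs P n (e i) (c i) (poly p0 (tsize (e i)))"
    using assms(1) by (rule ptimeE) blast
  obtain p :: "nat poly" where p: "\<And>n. \<exists>P. \<forall>i. runs P n (e i) (f i) (poly p (tsize (e i)))"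
    using assms(2) by (rule ptimeE) blast
  obtain q :: "nat poly" where q: "\<And>n. \<exists>P. \<forall>i. runs P n (e i) (g i) (poly q (tsize (e i)))"
    using assms(3) by (rule ptimeE) blast
  obtain r :: "nat poly" where r: "\<And>i. tsize (c i) \<le> poly r (tsize (e i))"
    using assms(1) by (rule ptime_tsize) blast
  let ?b = "[:10, 1:] + p0 + p + q + r"
  show ?thesis unfolding ptime_def
  proof (intro exI[of _ "?b"] allI)
    fix n
    obtain C P Q where C: "\<And>i. runs C (n+1) (e i) (c i) (poly p0 (tsize (e i)))"
      and P: "\<And>i. runs P n (e i) (f i) (poly p (tsize (e i)))"
      and Q: "\<And>i. runs Q n (e i) (g i) (poly q (tsize (e i)))"
      using p0[of "n+1"] p[of n] q[of n] by blast
    let ?A = "Seq (Assign (n+1) (EVar n)) C" and ?B = "Cond (EVar (n+1)) P Q"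
    have "runs (Seq ?A ?B) n (e i) (if c i \<noteq> Leaf then f i else g i) (poly ?b (tsize (e i)))" for i
    proof (rule runsI)
      fix s :: store assume s: "s n = e i"
      obtain t s1 where 1: "exec ?A s t s1" "s1 (n+1) = c i" "\<forall>i<n+1. s1 i = s i"
        "t \<le> 3 + tsize (e i) + poly p0 (tsize (e i))"
        using runs_call[where s = s and n = n, OF C[of i] s] by blast
      have s1: "s1 n = e i" using 1 s by simp
      obtain t' s2 where 2: "exec ?B s1 t' s2" "s2 n = (if c i \<noteq> Leaf then f i else g i)"
        "\<forall>i<n. s2 i = s1 i"
        "t' \<le> 1 + tsize (c i) + poly p (tsize (e i)) + poly q (tsize (e i))"
      proof (cases "c i = Leaf")
        case True
        obtain t s' where *: "exec Q s1 t s'" "s' n = g i" "\<forall>j<n. s' j = s1 j"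
            "t \<le> poly q (tsize (e i))"
          using Q[of i] s1 unfolding runs_def by blast
        show thesis
          by (rule that[OF exec.CondFalse[OF _ *(1)]]) (use True * 1 in auto)
      next
        case False
        obtain t s' where *: "exec P s1 t s'" "s' n = f i" "\<forall>j<n. s' j = s1 j"
            "t \<le> poly p (tsize (e i))"
          using P[of i] s1 unfolding runs_def by blast
        show thesis
          by (rule that[OF exec.CondTrue[OF _ *(1)]]) (use False * 1 in auto)
      qed
      show "\<exists>t s'. exec (Seq ?A ?B) s t s' \<and> s' n = (if c i \<noteq> Leaf then f i else g i) \<and>
          (\<forall>j<n. s' j = s j) \<and> t \<le> poly ?b (tsize (e i))"
        using 1(2-4) 2(2-4) r[of i]
        by - (intro exI conjI, rule exec.Seq[OF 1(1) 2(1)], auto simp: algebra_simps)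
    qed
    then show "\<exists>P. \<forall>i. runs P n (e i) (if c i \<noteq> Leaf then f i else g i) (poly ?b (tsize (e i)))"
      by blast
  qed
qed

section \<open>Loops over lists\<close>

lemma length_le_tsize: "length xs \<le> tsize (enc_list xs)"
  by (induction xs) auto

text \<open>Variable \<open>n\<close> keeps the environment, \<open>v\<close> the rest of the list,
  \<open>w\<close> the accumulator; \<open>z\<close> receives all three current values packed into
  one tree and is the base of the body \<open>P\<close>, which therefore preserves the other three.
  The number \<open>B\<close> bounds every value the loop meets.\<close>

lemma exec_fold_loop:
  fixes n :: nat
  defines "v \<equiv> Suc n" and "w \<equiv> Suc (Suc n)" and "z \<equiv> Suc (Suc (Suc n))"
  assumes step: "\<And>a x. runs P z (Node E (Node (ea a) (ex x))) (ea (st x a))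
      (poly p (tsize (Node E (Node (ea a) (ex x)))))"
    and "s n = E" "s v = enc_list (map ex l)" "s w = ea a"
    and "tsize E \<le> B" "tsize (enc_list (map ex l)) \<le> B"
    and "\<And>ys zs. l = ys @ zs \<Longrightarrow> tsize (ea (fold st ys a)) \<le> B"
  shows "\<exists>t s'. exec (While (EVar v) (Seq (Assign z (ENode (EVar n) (ENode (EVar w) (ELeft (EVar v)))))
      (Seq P (Seq (Assign w (EVar z)) (Assign v (ERight (EVar v))))))) s t s' \<and>
    s' w = ea (fold st l a) \<and> (\<forall>j\<le>n. s' j = s j) \<and>
    t \<le> (length l + 1) * (20 + 20 * B + poly p (2 + 3 * B))"
  using assms(5-)
proof (induction l arbitrary: a s)
  case Nil
  then have "exec (While (EVar v) C) s (1 + 1) s" for C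
    using exec.WhileFalse[of "EVar v" s C] by simp
  from this show ?case using Nil by (intro exI conjI) (assumption, auto)
next
  case (Cons x l)
  let ?A = "Assign z (ENode (EVar n) (ENode (EVar w) (ELeft (EVar v))))"
  let ?C = "Assign w (EVar z)" and ?D = "Assign v (ERight (EVar v))"
  let ?W = "While (EVar v) (Seq ?A (Seq P (Seq ?C ?D)))"
  have vwz: "v \<noteq> w" "v \<noteq> z" "w \<noteq> z" "n \<noteq> v" "n \<noteq> w" "n \<noteq> z" "v < z" "w < z" "n < z"
    by (auto simp: v_def w_def z_def)
  let ?N = "Node E (Node (ea a) (ex x))"
  have B: "tsize (ea a) \<le> B" "tsize (ea (st x a)) \<le> B"
    using Cons.prems(6)[of "[]" "x # l"] Cons.prems(6)[of "[x]" l] by auto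
  have X: "tsize (ex x) \<le> B" "tsize (enc_list (map ex l)) \<le> B"
    "1 + tsize (ex x) + tsize (enc_list (map ex l)) \<le> B"
    using Cons.prems(5) by auto
  let ?s1 = "s(z := ?N)"
  have e1: "exec ?A s (1 + eval_cost (ENode (EVar n) (ENode (EVar w) (ELeft (EVar v)))) s) ?s1"
    using exec.Assign[of z "ENode (EVar n) (ENode (EVar w) (ELeft (EVar v)))" s] Cons.prems by simp
  have c1: "eval_cost (ENode (EVar n) (ENode (EVar w) (ELeft (EVar v)))) s \<le> 1 + 9 * B"
    using Cons.prems(1-5) B X by simp
  have "?s1 z = ?N" by simp
  with runsD[OF step[of a x], of ?s1]
  obtain t2 s2 where e2: "exec P ?s1 t2 s2" "s2 z = ea (st x a)" "\<forall>j<z. s2 j = ?s1 j"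
    "t2 \<le> poly p (tsize ?N)"
    by blast
  have "poly p (tsize ?N) \<le> poly p (2 + 3 * B)"
    using Cons.prems(4) B X by (intro poly_nat_mono) auto
  then have c2: "t2 \<le> poly p (2 + 3 * B)" using e2 by linarith
  let ?s3 = "s2(w := ea (st x a))"
  have e3: "exec ?C s2 (1 + tsize (ea (st x a))) ?s3"
    using exec.Assign[of w "EVar z" s2] e2 by simp
  let ?s4 = "?s3(v := enc_list (map ex l))"
  have v3: "?s3 v = enc_list (map ex (x # l))" using e2(3) vwz Cons.prems(2) by simp
  have e4: "exec ?D ?s3 (1 + eval_cost (ERight (EVar v)) ?s3) ?s4"
    using exec.Assign[of v "ERight (EVar v)" ?s3] v3 by simp
  have c4: "eval_cost (ERight (EVar v)) ?s3 \<le> 2 * B"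
    using v3 Cons.prems(5) X by simp
  have pre: "?s4 n = E" "?s4 v = enc_list (map ex l)" "?s4 w = ea (st x a)"
    using e2(3) vwz Cons.prems(1) by auto
  have "\<exists>t s'. exec ?W ?s4 t s' \<and> s' w = ea (fold st l (st x a)) \<and> (\<forall>j\<le>n. s' j = ?s4 j) \<and>
     t \<le> (length l + 1) * (20 + 20 * B + poly p (2 + 3 * B))"
    by (rule Cons.IH[OF pre Cons.prems(4) X(2)]) (use Cons.prems(6)[of "x # _"] in auto)
  then obtain t5 s5 where e5: "exec ?W ?s4 t5 s5" "s5 w = ea (fold st l (st x a))"
    "\<forall>j\<le>n. s5 j = ?s4 j" "t5 \<le> (length l + 1) * (20 + 20 * B + poly p (2 + 3 * B))" by blast
  note body = exec.Seq[OF e1 exec.Seq[OF e2(1) exec.Seq[OF e3 e4]]]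
  have ne: "eval (EVar v) s \<noteq> Leaf" using Cons.prems(2) by simp
  have pres: "\<forall>j\<le>n. s5 j = s j" using e5(3) e2(3) vwz by (auto simp: v_def w_def z_def)
  have c0: "eval_cost (EVar v) s \<le> B" using Cons.prems(2,5) by simp
  \<comment> \<open>Cost of one round: evaluations outside \<open>P\<close> cost at most
    \<open>13 * B\<close> and a constant, and the packed argument of \<open>P\<close> has size at
    most \<open>2 + 3 * B\<close>.\<close>
  define K where "K = 20 + 20 * B + poly p (2 + 3 * B)"
  have "t5 \<le> (length l + 1) * K" using e5(4) by (simp only: K_def)
  then have "1 + eval_cost (EVar v) s + (1 + (1 + eval_cost (ENode (EVar n) (ENode (EVar w) (ELeft (EVar v)))) s) +
      (1 + t2 + (1 + (1 + tsize (ea (st x a))) + (1 + eval_cost (ERight (EVar v)) ?s3)))) + t5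
      \<le> K + (length l + 1) * K"
    using c0 c1 c2 c4 B(2) unfolding K_def by linarith
  also have "\<dots> = (length (x # l) + 1) * K" by simp
  finally show ?case
    using e5(2) pres unfolding K_def
    by - (intro exI conjI, rule exec.WhileTrue[OF ne body e5(1)], simp_all only: fold_simps)
qed

text \<open>A polynomial-time step may double its accumulator, so iterating it could take
  exponential time. Hence \<open>q\<close> has to bound the accumulator after every prefix of the
  list in terms of the original environment.\<close>

lemma ptime_fold:
  fixes q :: "nat poly"
  assumes step: "ptime (\<lambda>(i, a, x). Node (e i) (Node (ea a) (ex x))) (\<lambda>(i, a, x). ea (st i x a))"
    and l: "ptime e (\<lambda>i. enc_list (map ex (l i)))"
    and a: "ptime e (\<lambda>i. ea (a0 i))"
    and q: "\<And>i ys zs. l i = ys @ zs \<Longrightarrow> tsize (ea (fold (st i) ys (a0 i))) \<le> poly q (tsize (e i))"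
  shows "ptime e (\<lambda>i. ea (fold (st i) (l i) (a0 i)))"
proof -
  obtain ps :: "nat poly" where "\<And>n. \<exists>P. \<forall>i. runs P n ((\<lambda>(i, a, x). Node (e i) (Node (ea a) (ex x))) i)
     ((\<lambda>(i, a, x). ea (st i x a)) i) (poly ps (tsize ((\<lambda>(i, a, x). Node (e i) (Node (ea a) (ex x))) i)))"
    using step by (rule ptimeE) blast
  then have ps: "\<exists>P. \<forall>i a x. runs P n (Node (e i) (Node (ea a) (ex x))) (ea (st i x a))
     (poly ps (tsize (Node (e i) (Node (ea a) (ex x)))))" for n
    by (simp add: split_paired_all)
  obtain p :: "nat poly" where p: "\<And>n. \<exists>P. \<forall>i. runs P n (e i) (enc_list (map ex (l i))) (poly p (tsize (e i)))"
    using l by (rule ptimeE) blast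
  obtain p' :: "nat poly" where p': "\<And>n. \<exists>P. \<forall>i. runs P n (e i) (ea (a0 i)) (poly p' (tsize (e i)))"
    using a by (rule ptimeE) blast
  obtain r :: "nat poly" where r: "\<And>i. tsize (enc_list (map ex (l i))) \<le> poly r (tsize (e i))"
    using l by (rule ptime_tsize) blast
  define bnd where "bnd = [:0, 1:] + r + q"
  let ?b = "[:20, 2:] + p + p' + q + (r + 1) * ([:20:] + [:20:] * bnd + pcompose ps ([:2:] + [:3:] * bnd))"
  show ?thesis unfolding ptime_def
  proof (intro exI[of _ "?b"] allI)
    fix n
    obtain S L A where S: "\<And>i a x. runs S (Suc (Suc (Suc n))) (Node (e i) (Node (ea a) (ex x))) (ea (st i x a))
        (poly ps (tsize (Node (e i) (Node (ea a) (ex x)))))"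
      and L: "\<And>i. runs L (n+1) (e i) (enc_list (map ex (l i))) (poly p (tsize (e i)))"
      and A: "\<And>i. runs A (n+2) (e i) (ea (a0 i)) (poly p' (tsize (e i)))"
      using ps[of "Suc (Suc (Suc n))"] p[of "n+1"] p'[of "n+2"] by blast
    let ?A = "Seq (Assign (n+1) (EVar n)) L" and ?B = "Seq (Assign (n+2) (EVar n)) A"
    let ?D = "Assign n (EVar (Suc (Suc n)))"
    define W where "W = While (EVar (Suc n)) (Seq (Assign (Suc (Suc (Suc n)))
        (ENode (EVar n) (ENode (EVar (Suc (Suc n))) (ELeft (EVar (Suc n))))))
      (Seq S (Seq (Assign (Suc (Suc n)) (EVar (Suc (Suc (Suc n))))) (Assign (Suc n) (ERight (EVar (Suc n)))))))"
    have "runs (Seq ?A (Seq ?B (Seq W ?D))) n (e i) (ea (fold (st i) (l i) (a0 i))) (poly ?b (tsize (e i)))" for i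
    proof (rule runsI)
      fix s :: store assume s: "s n = e i"
      obtain t1 s1 where 1: "exec ?A s t1 s1" "s1 (n+1) = enc_list (map ex (l i))" "\<forall>i<n+1. s1 i = s i"
        "t1 \<le> 3 + tsize (e i) + poly p (tsize (e i))"
        using runs_call[where s = s and n = n, OF L[of i] s] by blast
      have s1: "s1 n = e i" using 1 s by simp
      obtain t2 s2 where 2: "exec ?B s1 t2 s2" "s2 (n+2) = ea (a0 i)" "\<forall>i<n+2. s2 i = s1 i"
        "t2 \<le> 3 + tsize (e i) + poly p' (tsize (e i))"
        using runs_call[where s = s1 and n = n, OF A[of i] s1] by blast
      define B where "B = poly bnd (tsize (e i))"
      have B: "tsize (e i) \<le> B" "tsize (enc_list (map ex (l i))) \<le> B"
        "\<And>ys zs. l i = ys @ zs \<Longrightarrow> tsize (ea (fold (st i) ys (a0 i))) \<le> B"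
        using r[of i] q[of i] by (fastforce simp: B_def bnd_def)+
      have "\<exists>t s'. exec W s2 t s' \<and> s' (Suc (Suc n)) = ea (fold (st i) (l i) (a0 i)) \<and>
          (\<forall>j\<le>n. s' j = s2 j) \<and> t \<le> (length (l i) + 1) * (20 + 20 * B + poly ps (2 + 3 * B))"
        unfolding W_def
        by (rule exec_fold_loop[where E = "e i" and ex = ex, OF S]) (use 1 2 s B in auto)
      then obtain t3 s3 where 3: "exec W s2 t3 s3" "s3 (Suc (Suc n)) = ea (fold (st i) (l i) (a0 i))"
          "\<forall>j\<le>n. s3 j = s2 j" "t3 \<le> (length (l i) + 1) * (20 + 20 * B + poly ps (2 + 3 * B))"
        by blast
      have 4: "exec ?D s3 (1 + tsize (ea (fold (st i) (l i) (a0 i)))) (s3(n := ea (fold (st i) (l i) (a0 i))))"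
        using exec.Assign[of n "EVar (Suc (Suc n))" s3] 3 by simp
      have len: "length (l i) \<le> poly r (tsize (e i))"
        using length_le_tsize[of "map ex (l i)"] r[of i] by simp
      have "t3 \<le> (poly r (tsize (e i)) + 1) * (20 + 20 * B + poly ps (2 + 3 * B))"
        by (rule order_trans[OF 3(4)]) (use len in \<open>intro mult_right_mono; simp\<close>)
      moreover have "tsize (ea (fold (st i) (l i) (a0 i))) \<le> poly q (tsize (e i))"
        using q[of i "l i" "[]"] by simp
      ultimately have time: "1 + t1 + (1 + t2 + (1 + t3 + (1 + tsize (ea (fold (st i) (l i) (a0 i))))))
          \<le> poly ?b (tsize (e i))"
        using 1(4) 2(4) by (simp add: poly_pcompose B_def)
      have pres: "\<forall>j<n. (s3(n := ea (fold (st i) (l i) (a0 i)))) j = s j"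
        using 1(3) 2(3) 3(3) by simp
      show "\<exists>t s'. exec (Seq ?A (Seq ?B (Seq W ?D))) s t s' \<and> s' n = ea (fold (st i) (l i) (a0 i)) \<and>
          (\<forall>j<n. s' j = s j) \<and> t \<le> poly ?b (tsize (e i))"
        using time pres
        by - (intro exI conjI, rule exec.Seq[OF 1(1) exec.Seq[OF 2(1) exec.Seq[OF 3(1) 4]]],
          simp_all only: fun_upd_same)
    qed
    then show "\<exists>P. \<forall>i. runs P n (e i) (ea (fold (st i) (l i) (a0 i))) (poly ?b (tsize (e i)))"
      by blast
  qed
qed


section \<open>Greedy lists\<close>

definition greedy :: "('a list \<Rightarrow> 'a \<Rightarrow> bool) \<Rightarrow> 'a list \<Rightarrow> 'a list" where
  "greedy P xs = fold (\<lambda>x H. if P H x then x # H else H) xs []"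

lemma greedy_Nil [simp]: "greedy P [] = []"
  by (simp add: greedy_def)

lemma greedy_snoc:
  "greedy P (xs @ [x]) = (if P (greedy P xs) x then x # greedy P xs else greedy P xs)"
  by (simp add: greedy_def)

lemma greedy_subset: "set (greedy P xs) \<subseteq> set xs"
  by (induction xs rule: rev_induct) (auto simp: greedy_snoc)

text \<open>Rule for invariants of the kept list. Distinctness of \<open>xs\<close> makes every
  candidate fresh.\<close>

lemma greedy_induct [consumes 1, case_names Nil Cons]:
  assumes "distinct xs" "Q []"
    and step: "\<And>H x. x \<in> set xs \<Longrightarrow> x \<notin> set H \<Longrightarrow> set H \<subseteq> set xs \<Longrightarrow> P H x \<Longrightarrow> Q H \<Longrightarrow> Q (x # H)"
  shows "Q (greedy P xs)"
proof -
  have "distinct ys \<Longrightarrow> set ys \<subseteq> set xs \<Longrightarrow> Q (greedy P ys)" for ys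
  proof (induction ys rule: rev_induct)
    case (snoc y ys)
    then show ?case using greedy_subset[of P ys] by (auto simp: greedy_snoc intro!: step)
  qed (simp add: assms)
  then show ?thesis using assms(1) by simp
qed

lemma distinct_greedy: "distinct xs \<Longrightarrow> distinct (greedy P xs)"
  by (erule greedy_induct) auto

text \<open>Kept elements are put in front, so the list against which \<open>x\<close> was tested
  survives as the suffix \<open>H\<close> of the final list.\<close>

lemma greedy_rejected:
  "x \<in> set xs \<Longrightarrow> x \<notin> set (greedy P xs) \<Longrightarrow> \<exists>G H. greedy P xs = G @ H \<and> \<not> P H x"
proof (induction xs rule: rev_induct)
  case (snoc y ys)
  show ?case
  proof (cases "x \<in> set ys")
    case True
    then obtain G H where "greedy P ys = G @ H" "\<not> P H x"
      using snoc by (auto simp: greedy_snoc split: if_splits)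
    then show ?thesis by (auto simp: greedy_snoc intro: exI[of _ "y # G"])
  next
    case False
    then show ?thesis using snoc by (auto simp: greedy_snoc split: if_splits)
  qed
qed simp

lemma greedy_map:
  assumes "\<And>H x. set H \<subseteq> set xs \<Longrightarrow> x \<in> set xs \<Longrightarrow> P (map f H) (f x) = P' H x"
  shows "greedy P (map f xs) = map f (greedy P' xs)"
proof -
  have "set ys \<subseteq> set xs \<Longrightarrow> greedy P (map f ys) = map f (greedy P' ys)" for ys
  proof (induction ys rule: rev_induct)
    case (snoc y ys)
    then show ?case using greedy_subset[of P' ys] assms[of "greedy P' ys" y]
      by (auto simp: greedy_snoc)
  qed simp
  then show ?thesis by simp
qed


section \<open>Loops, numbers and lists\<close>

lemma tsize_enc_list: "tsize (enc_list xs) = 1 + (\<Sum>x\<leftarrow>xs. 1 + tsize x)"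
  by (induction xs) auto

lemma tsize_enc_list_le:
  "(\<And>x. x \<in> set xs \<Longrightarrow> tsize x \<le> B) \<Longrightarrow> tsize (enc_list xs) \<le> 1 + length xs * (1 + B)"
  by (induction xs) (force simp: algebra_simps)+

lemma tsize_member: "x \<in> set xs \<Longrightarrow> tsize x \<le> tsize (enc_list xs)"
  by (induction xs) auto

text \<open>A program for \<open>f\<close> also serves in a larger environment \<open>d\<close>: the
  smaller encoding \<open>e (h j)\<close> is extracted from it beforehand.\<close>

lemma ptime_lift:
  assumes "ptime d (\<lambda>j. e (h j))" "ptime e f"
  shows "ptime d (\<lambda>j. f (h j))"
  using ptime_comp[OF assms(1)] ptime_reindex[OF assms(2), of h] by blast

text \<open>
  The bodies of loops are shown to be computable in an unknown encoding \<open>e'\<close> of the extended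
  environment, which only has to give access to everything computable before and to the new
  variables.
\<close>

lemma ptime_subst:
  assumes "\<And>e' :: 'i \<times> 'x \<Rightarrow> btree. \<lbrakk>\<And>f. ptime e f \<Longrightarrow> ptime e' (\<lambda>j. f (fst j));
      ptime e' (\<lambda>j. ex (snd j))\<rbrakk> \<Longrightarrow> ptime e' (\<lambda>j. h (fst j) (snd j))"
    and "ptime d (\<lambda>j. e (f j))" "ptime d (\<lambda>j. ex (g j))"
  shows "ptime d (\<lambda>j. h (f j) (g j))"
proof -
  let ?e' = "\<lambda>j. Node (e (fst j)) (ex (snd j))"
  have "ptime ?e' (\<lambda>j. h (fst j) (snd j))"
    by (rule assms(1)) (rule ptime_lift[where e = e], rule ptime_fst[OF ptime_id], assumption,
      rule ptime_snd[OF ptime_id])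
  from ptime_lift[where h = "\<lambda>j. (f j, g j)", OF _ this] show ?thesis
    using ptime_Node[OF assms(2,3)] by simp
qed

lemma ptime_foldI:
  fixes q :: "nat poly"
  assumes l: "ptime e (\<lambda>i. enc_list (map ex (l i)))"
    and a: "ptime e (\<lambda>i. ea (a0 i))"
    and q: "\<And>i ys zs. l i = ys @ zs \<Longrightarrow> tsize (ea (fold (st i) ys (a0 i))) \<le> poly q (tsize (e i))"
    and step: "\<And>e' :: 'i \<times> 'a \<times> 'x \<Rightarrow> btree.
      \<lbrakk>\<And>f. ptime e f \<Longrightarrow> ptime e' (\<lambda>j. f (fst j)); ptime e' (\<lambda>j. ea (fst (snd j)));
       ptime e' (\<lambda>j. ex (snd (snd j)))\<rbrakk> \<Longrightarrow>
      ptime e' (\<lambda>j. ea (st (fst j) (snd (snd j)) (fst (snd j))))"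
  shows "ptime e (\<lambda>i. ea (fold (st i) (l i) (a0 i)))"
proof (rule ptime_fold[OF _ l a q])
  let ?e' = "\<lambda>j. Node (e (fst j)) (Node (ea (fst (snd j))) (ex (snd (snd j))))"
  have "ptime ?e' (\<lambda>j. ea (st (fst j) (snd (snd j)) (fst (snd j))))"
    by (rule step) (rule ptime_lift[where e = e], rule ptime_fst[OF ptime_id], assumption,
      rule ptime_fst[OF ptime_snd[OF ptime_id]], rule ptime_snd[OF ptime_snd[OF ptime_id]])
  then show "ptime (\<lambda>(i, a, x). Node (e i) (Node (ea a) (ex x))) (\<lambda>(i, a, x). ea (st i x a))"
    by (simp add: case_prod_beta')
qed assumption

section \<open>Truth values and unary numbers\<close>

lemma enc_bool_simps [simp]: "enc_bool False = Leaf" "enc_bool True = Node Leaf Leaf"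
  "enc_bool b = Leaf \<longleftrightarrow> \<not> b"
  by (simp_all add: enc_bool_def)

lemma tsize_enc_bool: "tsize (enc_bool b) \<le> 3"
  by (cases b) auto

lemma ptime_False: "ptime e (\<lambda>_. enc_bool False)"
  by (simp add: ptime_Leaf)

lemma ptime_True: "ptime e (\<lambda>_. enc_bool True)"
  by (simp add: ptime_Leaf ptime_Node)

lemma ptime_if:
  assumes "ptime e (\<lambda>i. enc_bool (b i))" "ptime e f" "ptime e g"
  shows "ptime e (\<lambda>i. if b i then f i else g i)"
  using ptime_if_Leaf[OF assms] by simp

lemma ptime_nonLeaf: "ptime e f \<Longrightarrow> ptime e (\<lambda>i. enc_bool (f i \<noteq> Leaf))"
  unfolding enc_bool_def[of "_ \<noteq> _"] by (intro ptime_if_Leaf ptime_Leaf ptime_Node)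

lemma ptime_not: "ptime e (\<lambda>i. enc_bool (b i)) \<Longrightarrow> ptime e (\<lambda>i. enc_bool (\<not> b i))"
  using ptime_if[OF _ ptime_False ptime_True] by (rule back_subst[of "ptime e"]) auto

lemma ptime_conj:
  "ptime e (\<lambda>i. enc_bool (b i)) \<Longrightarrow> ptime e (\<lambda>i. enc_bool (c i)) \<Longrightarrow> ptime e (\<lambda>i. enc_bool (b i \<and> c i))"
  using ptime_if[of e b "\<lambda>i. enc_bool (c i)", OF _ _ ptime_False] by (rule back_subst[of "ptime e"]) auto

lemma ptime_disj:
  "ptime e (\<lambda>i. enc_bool (b i)) \<Longrightarrow> ptime e (\<lambda>i. enc_bool (c i)) \<Longrightarrow> ptime e (\<lambda>i. enc_bool (b i \<or> c i))"
  using ptime_if[of e b _ "\<lambda>i. enc_bool (c i)", OF _ ptime_True] by (rule back_subst[of "ptime e"]) auto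

text \<open>Counters inside the algorithm stay polynomially bounded, so unary notation is
  affordable. Successor, predecessor and the test for zero become single tree operations.\<close>

definition un :: "nat \<Rightarrow> btree" where
  "un n = enc_list (replicate n Leaf)"

lemma un_simps [simp]: "un 0 = Leaf" "un (Suc n) = Node Leaf (un n)" "right (un n) = un (n - 1)"
  "un n = Leaf \<longleftrightarrow> n = 0" "tsize (un n) = 2 * n + 1"
proof -
  show 1: "un 0 = Leaf" "un (Suc n) = Node Leaf (un n)" for n by (simp_all add: un_def)
  show "right (un n) = un (n - 1)" "un n = Leaf \<longleftrightarrow> n = 0" by (cases n; simp add: 1)+
  show "tsize (un n) = 2 * n + 1" by (induction n) (simp_all add: 1)
qed

lemma ptime_0: "ptime e (\<lambda>_. un 0)"
  by (simp add: ptime_Leaf)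

lemma ptime_Suc: "ptime e (\<lambda>i. un (a i)) \<Longrightarrow> ptime e (\<lambda>i. un (Suc (a i)))"
  by (simp add: ptime_Leaf ptime_Node)

lemma ptime_pred: "ptime e (\<lambda>i. un (a i)) \<Longrightarrow> ptime e (\<lambda>i. un (a i - 1))"
  using ptime_right[of e "\<lambda>i. un (a i)"] by simp

lemma ptime_pos: "ptime e (\<lambda>i. un (a i)) \<Longrightarrow> ptime e (\<lambda>i. enc_bool (0 < a i))"
  using ptime_nonLeaf[of e "\<lambda>i. un (a i)"] by simp

lemma fold_replicate_unit: "fold (\<lambda>_. f) (replicate n ()) a = (f ^^ n) a"
  by (induction n arbitrary: a) (simp_all add: funpow_swap1)

text \<open>The tree \<open>un n\<close> is also the encoding of a list of \<open>n\<close> units,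
  so a counted loop is a fold over that list.\<close>

lemma ptime_iterate:
  fixes q :: "nat poly"
  assumes n: "ptime e (\<lambda>i. un (n i))" and a: "ptime e (\<lambda>i. ea (a0 i))"
    and q: "\<And>i m. m \<le> n i \<Longrightarrow> tsize (ea ((st i ^^ m) (a0 i))) \<le> poly q (tsize (e i))"
    and step: "\<And>e' :: 'i \<times> 'a \<Rightarrow> btree.
      \<lbrakk>\<And>f. ptime e f \<Longrightarrow> ptime e' (\<lambda>j. f (fst j)); ptime e' (\<lambda>j. ea (snd j))\<rbrakk> \<Longrightarrow>
      ptime e' (\<lambda>j. ea (st (fst j) (snd j)))"
  shows "ptime e (\<lambda>i. ea ((st i ^^ n i) (a0 i)))"
proof -
  have "ptime e (\<lambda>i. ea (fold (\<lambda>_. st i) (replicate (n i) ()) (a0 i)))"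
  proof (rule ptime_foldI[where ex = "\<lambda>_. Leaf" and ea = ea and q = q, OF _ a])
    show "ptime e (\<lambda>i. enc_list (map (\<lambda>_. Leaf) (replicate (n i) ())))"
      using n by (simp add: un_def)
    fix i ys zs assume "replicate (n i) () = ys @ zs"
    then have "ys = replicate (length ys) ()" "length ys \<le> n i"
      by (metis append_eq_append_conv_if append_eq_conv_conj length_replicate take_replicate
          min.cobounded2 min_def nat_le_linear take_all)
        (metis \<open>replicate (n i) () = ys @ zs\<close> length_append length_replicate le_add1)
    then show "tsize (ea (fold (\<lambda>_. st i) ys (a0 i))) \<le> poly q (tsize (e i))"
      using q[of "length ys" i] by (metis fold_replicate_unit)
  next
    fix e' :: "'i \<times> 'a \<times> unit \<Rightarrow> btree"
    assume *: "\<And>f. ptime e f \<Longrightarrow> ptime e' (\<lambda>j. f (fst j))" "ptime e' (\<lambda>j. ea (fst (snd j)))"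
    show "ptime e' (\<lambda>j. ea (st (fst j) (fst (snd j))))"
      by (rule ptime_subst[where e = e and ex = ea and f = fst and g = "\<lambda>j. fst (snd j)"
          and h = "\<lambda>i a. ea (st i a)"])
        (rule step, assumption+, rule *, rule ptime_id, rule *)
  qed
  then show ?thesis by (simp add: fold_replicate_unit)
qed

lemma ptime_add:
  assumes "ptime e (\<lambda>i. un (a i))" "ptime e (\<lambda>i. un (b i))"
  shows "ptime e (\<lambda>i. un (a i + b i))"
proof -
  obtain p :: "nat poly" where p: "\<And>i. tsize (un (a i)) \<le> poly p (tsize (e i))"
    using assms(1) by (rule ptime_tsize) blast
  obtain q :: "nat poly" where q: "\<And>i. tsize (un (b i)) \<le> poly q (tsize (e i))"
    using assms(2) by (rule ptime_tsize) blast
  have iter: "(Suc ^^ m) x = x + m" for m x by (induction m) auto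
  have "ptime e (\<lambda>i. un ((Suc ^^ b i) (a i)))"
  proof (rule ptime_iterate[where ea = un and q = "p + q", OF assms(2,1)])
    show "tsize (un ((Suc ^^ m) (a i))) \<le> poly (p + q) (tsize (e i))" if "m \<le> b i" for i m
      using p[of i] q[of i] that by (simp add: iter)
  qed (rule ptime_Suc)
  then show ?thesis by (simp add: add.commute)
qed

lemma ptime_diff:
  assumes "ptime e (\<lambda>i. un (a i))" "ptime e (\<lambda>i. un (b i))"
  shows "ptime e (\<lambda>i. un (a i - b i))"
proof -
  obtain p :: "nat poly" where p: "\<And>i. tsize (un (a i)) \<le> poly p (tsize (e i))"
    using assms(1) by (rule ptime_tsize) blast
  have iter: "((\<lambda>x. x - 1) ^^ m) x = x - m" for m x :: nat by (induction m) auto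
  have "ptime e (\<lambda>i. un (((\<lambda>x. x - 1) ^^ b i) (a i)))"
  proof (rule ptime_iterate[where ea = un and q = p, OF assms(2,1)])
    show "tsize (un (((\<lambda>x. x - 1) ^^ m) (a i))) \<le> poly p (tsize (e i))" for i m
      using p[of i] unfolding iter by simp
  qed (rule ptime_pred)
  then show ?thesis unfolding iter .
qed

lemma ptime_mult:
  fixes e :: "'i \<Rightarrow> btree"
  assumes "ptime e (\<lambda>i. un (a i))" "ptime e (\<lambda>i. un (b i))"
  shows "ptime e (\<lambda>i. un (a i * b i))"
proof -
  obtain p :: "nat poly" where p: "\<And>i. tsize (un (a i)) \<le> poly p (tsize (e i))"
    using assms(1) by (rule ptime_tsize) blast
  obtain q :: "nat poly" where q: "\<And>i. tsize (un (b i)) \<le> poly q (tsize (e i))"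
    using assms(2) by (rule ptime_tsize) blast
  have iter: "((+) x ^^ m) 0 = x * m" for m x :: nat by (induction m) auto
  have "ptime e (\<lambda>i. un (((+) (a i) ^^ b i) 0))"
  proof (rule ptime_iterate[where ea = un and q = "p * q", OF assms(2) ptime_0])
    fix i m assume m: "m \<le> b i"
    have "2 * (a i * m) + 1 \<le> (2 * a i + 1) * (2 * b i + 1)"
    proof -
      have "(2 * a i + 1) * (2 * b i + 1) = 4 * (a i * b i) + 2 * a i + 2 * b i + 1"
        by (simp add: algebra_simps)
      then show ?thesis using mult_le_mono2[OF m, of "a i"] by linarith
    qed
    also have "\<dots> \<le> poly p (tsize (e i)) * poly q (tsize (e i))"
      using p[of i] q[of i] by (intro mult_le_mono) simp_all
    finally show "tsize (un (((+) (a i) ^^ m) 0)) \<le> poly (p * q) (tsize (e i))"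
      by (simp add: iter)
  next
    fix e' :: "'i \<times> nat \<Rightarrow> btree"
    assume *: "\<And>f. ptime e f \<Longrightarrow> ptime e' (\<lambda>j. f (fst j))" "ptime e' (\<lambda>j. un (snd j))"
    show "ptime e' (\<lambda>j. un (a (fst j) + snd j))" by (rule ptime_add[OF *(1)[OF assms(1)] *(2)])
  qed
  then show ?thesis by (simp add: iter)
qed

lemma ptime_less:
  assumes "ptime e (\<lambda>i. un (a i))" "ptime e (\<lambda>i. un (b i))"
  shows "ptime e (\<lambda>i. enc_bool (a i < b i))"
  using ptime_pos[OF ptime_diff[OF assms(2,1)]] by simp

lemma ptime_eq:
  assumes "ptime e (\<lambda>i. un (a i))" "ptime e (\<lambda>i. un (b i))"
  shows "ptime e (\<lambda>i. enc_bool (a i = b i))"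
  using ptime_conj[OF ptime_not[OF ptime_less[OF assms]] ptime_not[OF ptime_less[OF assms(2,1)]]]
  by (simp add: not_less eq_iff conj_commute)

lemma ptime_min:
  assumes "ptime e (\<lambda>i. un (a i))" "ptime e (\<lambda>i. un (b i))"
  shows "ptime e (\<lambda>i. un (min (a i) (b i)))"
proof -
  have "x - (x - y) = min x y" for x y :: nat by simp
  with ptime_diff[OF assms(1) ptime_diff[OF assms]] show ?thesis by (simp only:)
qed

section \<open>Operations on lists\<close>

lemma ptime_Nil: "ptime e (\<lambda>_. enc_list (map ex []))"
  by (simp add: ptime_Leaf)

lemma ptime_Cons:
  "ptime e (\<lambda>i. ex (x i)) \<Longrightarrow> ptime e (\<lambda>i. enc_list (map ex (l i))) \<Longrightarrow>
    ptime e (\<lambda>i. enc_list (map ex (x i # l i)))"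
  by (simp add: ptime_Node)

lemma ptime_length:
  fixes e :: "'i \<Rightarrow> btree" and ex :: "'x \<Rightarrow> btree"
  assumes l: "ptime e (\<lambda>i. enc_list (map ex (l i)))"
  shows "ptime e (\<lambda>i. un (length (l i)))"
proof -
  obtain p :: "nat poly" where p: "\<And>i. tsize (enc_list (map ex (l i))) \<le> poly p (tsize (e i))"
    using l by (rule ptime_tsize) blast
  have fold: "fold (\<lambda>_. Suc) xs n = n + length xs" for xs :: "'x list" and n
    by (induction xs arbitrary: n) auto
  have "ptime e (\<lambda>i. un (fold (\<lambda>_. Suc) (l i) 0))"
  proof (rule ptime_foldI[where ex = ex and ea = un and q = "1 + [:2:] * p", OF l ptime_0])
    show "tsize (un (fold (\<lambda>_. Suc) ys 0)) \<le> poly (1 + [:2:] * p) (tsize (e i))"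
      if "l i = ys @ zs" for i ys zs
      using length_le_tsize[of "map ex (l i)"] p[of i] that by (simp add: fold)
  qed (rule ptime_Suc)
  then show ?thesis by (simp add: fold)
qed

text \<open>Taking tails and then the head never fails on trees: beyond the end it yields
  \<open>Leaf\<close>, which is why the default has to be encoded by \<open>Leaf\<close>.\<close>

lemma ptime_nth_default:
  fixes e :: "'i \<Rightarrow> btree" and ex :: "'x \<Rightarrow> btree"
  assumes l: "ptime e (\<lambda>i. enc_list (map ex (l i)))" and a: "ptime e (\<lambda>i. un (a i))"
    and d: "ex d = Leaf"
  shows "ptime e (\<lambda>i. ex (nth_default d (l i) (a i)))"
proof -
  obtain p :: "nat poly" where p: "\<And>i. tsize (enc_list (map ex (l i))) \<le> poly p (tsize (e i))"
    using l by (rule ptime_tsize) blast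
  have iter: "(tl ^^ m) xs = drop m xs" for m and xs :: "'x list"
    by (induction m) (simp_all add: drop_Suc drop_tl)
  have size: "tsize (enc_list (map ex (drop m xs))) \<le> tsize (enc_list (map ex xs))" for m xs
  proof (induction xs arbitrary: m)
    case (Cons x xs)
    show ?case
    proof (cases m)
      case (Suc k)
      then show ?thesis using Cons[of k] by simp
    qed simp
  qed simp
  have "ptime e (\<lambda>i. enc_list (map ex ((tl ^^ a i) (l i))))"
  proof (rule ptime_iterate[where ea = "\<lambda>xs. enc_list (map ex xs)" and q = p, OF a l])
    show "tsize (enc_list (map ex ((tl ^^ m) (l i)))) \<le> poly p (tsize (e i))" for i m
      using p[of i] size[of m "l i"] by (simp add: iter)
  next
    fix e' :: "'i \<times> 'x list \<Rightarrow> btree"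
    assume *: "ptime e' (\<lambda>j. enc_list (map ex (snd j)))"
    have "right (enc_list (map ex xs)) = enc_list (map ex (tl xs))" for xs by (cases xs) auto
    then show "ptime e' (\<lambda>j. enc_list (map ex (tl (snd j))))"
      using ptime_right[OF *] by simp
  qed
  from ptime_left[OF this] have "ptime e (\<lambda>i. left (enc_list (map ex (drop (a i) (l i)))))"
    by (simp add: iter)
  moreover have "left (enc_list (map ex (drop n xs))) = ex (nth_default d xs n)" for n xs
    by (induction xs arbitrary: n) (auto simp: d drop_Cons nth_default_Cons split: nat.split)
  ultimately show ?thesis by simp
qed

lemma ptime_Bex:
  fixes e :: "'i \<Rightarrow> btree" and ex :: "'x \<Rightarrow> btree"
  assumes l: "ptime e (\<lambda>i. enc_list (map ex (l i)))"
    and P: "\<And>e' :: 'i \<times> 'x \<Rightarrow> btree. \<lbrakk>\<And>f. ptime e f \<Longrightarrow> ptime e' (\<lambda>j. f (fst j));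
      ptime e' (\<lambda>j. ex (snd j))\<rbrakk> \<Longrightarrow> ptime e' (\<lambda>j. enc_bool (P (fst j) (snd j)))"
  shows "ptime e (\<lambda>i. enc_bool (\<exists>x\<in>set (l i). P i x))"
proof -
  have fold: "fold (\<lambda>x b. b \<or> Q x) xs b \<longleftrightarrow> b \<or> (\<exists>x\<in>set xs. Q x)" for Q xs b
    by (induction xs arbitrary: b) auto
  have "ptime e (\<lambda>i. enc_bool (fold (\<lambda>x b. b \<or> P i x) (l i) False))"
  proof (rule ptime_foldI[where ex = ex and ea = enc_bool and q = "[:3:]", OF l ptime_False])
    fix e' :: "'i \<times> bool \<times> 'x \<Rightarrow> btree"
    assume *: "\<And>f. ptime e f \<Longrightarrow> ptime e' (\<lambda>j. f (fst j))"
      "ptime e' (\<lambda>j. enc_bool (fst (snd j)))" "ptime e' (\<lambda>j. ex (snd (snd j)))"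
    have body: "ptime e' (\<lambda>j. enc_bool (P (fst j) (snd (snd j))))"
      by (rule ptime_subst[where e = e and ex = ex and f = fst and g = "\<lambda>j. snd (snd j)"
          and h = "\<lambda>i x. enc_bool (P i x)"]) (rule P, assumption+, rule *(1)[OF ptime_id], rule *(3))
    show "ptime e' (\<lambda>j. enc_bool (fst (snd j) \<or> P (fst j) (snd (snd j))))"
      by (intro ptime_disj *(2) body)
  qed (simp add: tsize_enc_bool)
  then show ?thesis by (simp add: fold)
qed

text \<open>The loop counts down from \<open>c i\<close> with truncated subtraction and tests
  whether anything is left, so the counter never exceeds its initial value.\<close>

lemma ptime_count_less:
  fixes e :: "'i \<Rightarrow> btree" and ex :: "'x \<Rightarrow> btree"
  assumes l: "ptime e (\<lambda>i. enc_list (map ex (l i)))" and c: "ptime e (\<lambda>i. un (c i))"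
    and P: "\<And>e' :: 'i \<times> 'x \<Rightarrow> btree. \<lbrakk>\<And>f. ptime e f \<Longrightarrow> ptime e' (\<lambda>j. f (fst j));
      ptime e' (\<lambda>j. ex (snd j))\<rbrakk> \<Longrightarrow> ptime e' (\<lambda>j. enc_bool (P (fst j) (snd j)))"
  shows "ptime e (\<lambda>i. enc_bool (length (filter (P i) (l i)) < c i))"
proof -
  obtain p :: "nat poly" where p: "\<And>i. tsize (un (c i)) \<le> poly p (tsize (e i))"
    using c by (rule ptime_tsize) blast
  have fold: "fold (\<lambda>x r. if Q x then r - 1 else r) xs r = r - length (filter Q xs)" for Q xs and r :: nat
    by (induction xs arbitrary: r) auto
  have "ptime e (\<lambda>i. un (fold (\<lambda>x r. if P i x then r - 1 else r) (l i) (c i)))"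
  proof (rule ptime_foldI[where ex = ex and ea = un and q = p, OF l c])
    show "tsize (un (fold (\<lambda>x r. if P i x then r - 1 else r) ys (c i))) \<le> poly p (tsize (e i))" for i ys
      using p[of i] by (simp add: fold)
  next
    fix e' :: "'i \<times> nat \<times> 'x \<Rightarrow> btree"
    assume *: "\<And>f. ptime e f \<Longrightarrow> ptime e' (\<lambda>j. f (fst j))"
      "ptime e' (\<lambda>j. un (fst (snd j)))" "ptime e' (\<lambda>j. ex (snd (snd j)))"
    have body: "ptime e' (\<lambda>j. enc_bool (P (fst j) (snd (snd j))))"
      by (rule ptime_subst[where e = e and ex = ex and f = fst and g = "\<lambda>j. snd (snd j)"
          and h = "\<lambda>i x. enc_bool (P i x)"]) (rule P, assumption+, rule *(1)[OF ptime_id], rule *(3))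
    show "ptime e' (\<lambda>j. un (if P (fst j) (snd (snd j)) then fst (snd j) - 1 else fst (snd j)))"
      unfolding if_distrib[of un]
      by (intro ptime_if *(2) ptime_pred body)
  qed
  from ptime_pos[OF this] show ?thesis by (simp add: fold)
qed

lemma tsize_greedy: "tsize (enc_list (map ex (greedy P xs))) \<le> tsize (enc_list (map ex xs))"
  by (induction xs rule: rev_induct) (auto simp: greedy_snoc tsize_enc_list)

lemma ptime_greedy:
  fixes e :: "'i \<Rightarrow> btree" and ex :: "'x \<Rightarrow> btree"
  assumes l: "ptime e (\<lambda>i. enc_list (map ex (l i)))"
    and P: "\<And>e' :: 'i \<times> 'x list \<times> 'x \<Rightarrow> btree. \<lbrakk>\<And>f. ptime e f \<Longrightarrow> ptime e' (\<lambda>j. f (fst j));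
      ptime e' (\<lambda>j. enc_list (map ex (fst (snd j)))); ptime e' (\<lambda>j. ex (snd (snd j)))\<rbrakk> \<Longrightarrow>
      ptime e' (\<lambda>j. enc_bool (P (fst j) (fst (snd j)) (snd (snd j))))"
  shows "ptime e (\<lambda>i. enc_list (map ex (greedy (P i) (l i))))"
proof -
  obtain p :: "nat poly" where p: "\<And>i. tsize (enc_list (map ex (l i))) \<le> poly p (tsize (e i))"
    using l by (rule ptime_tsize) blast
  show ?thesis unfolding greedy_def
  proof (rule ptime_foldI[where ex = ex and ea = "\<lambda>xs. enc_list (map ex xs)" and q = p, OF l ptime_Nil])
    fix i ys zs assume "l i = ys @ zs"
    then have "tsize (enc_list (map ex ys)) \<le> poly p (tsize (e i))"
      using p[of i] by (simp add: tsize_enc_list)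
    then show "tsize (enc_list (map ex (fold (\<lambda>x H. if P i H x then x # H else H) ys []))) \<le> poly p (tsize (e i))"
      using tsize_greedy[of ex "P i" ys] by (simp add: greedy_def)
  next
    fix e' :: "'i \<times> 'x list \<times> 'x \<Rightarrow> btree"
    assume *: "\<And>f. ptime e f \<Longrightarrow> ptime e' (\<lambda>j. f (fst j))"
      "ptime e' (\<lambda>j. enc_list (map ex (fst (snd j))))" "ptime e' (\<lambda>j. ex (snd (snd j)))"
    show "ptime e' (\<lambda>j. enc_list (map ex (if P (fst j) (fst (snd j)) (snd (snd j))
        then snd (snd j) # fst (snd j) else fst (snd j))))"
      unfolding if_distrib[of "map ex"] if_distrib[of enc_list] by (intro ptime_if ptime_Cons P *)
  qed
qed

text \<open>A greedy scan that keeps everything reverses its list.\<close>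

lemma ptime_rev:
  fixes e :: "'i \<Rightarrow> btree" and ex :: "'x \<Rightarrow> btree"
  assumes l: "ptime e (\<lambda>i. enc_list (map ex (l i)))"
  shows "ptime e (\<lambda>i. enc_list (map ex (rev (l i))))"
proof -
  have "greedy (\<lambda>_ _. True) xs = rev xs" for xs :: "'x list"
    by (induction xs rule: rev_induct) (auto simp: greedy_snoc)
  with ptime_greedy[OF l, of "\<lambda>_ _ _. True", OF ptime_True] show ?thesis by (simp only:)
qed

lemma ptime_map_bool:
  fixes e :: "'i \<Rightarrow> btree" and ex :: "'x \<Rightarrow> btree"
  assumes l: "ptime e (\<lambda>i. enc_list (map ex (l i)))"
    and P: "\<And>e' :: 'i \<times> 'x \<Rightarrow> btree. \<lbrakk>\<And>f. ptime e f \<Longrightarrow> ptime e' (\<lambda>j. f (fst j));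
      ptime e' (\<lambda>j. ex (snd j))\<rbrakk> \<Longrightarrow> ptime e' (\<lambda>j. enc_bool (P (fst j) (snd j)))"
  shows "ptime e (\<lambda>i. enc_list (map enc_bool (map (P i) (l i))))"
proof -
  obtain p :: "nat poly" where p: "\<And>i. tsize (enc_list (map ex (l i))) \<le> poly p (tsize (e i))"
    using l by (rule ptime_tsize) blast
  have fold: "fold (\<lambda>x bs. Q x # bs) xs bs = rev (map Q xs) @ bs" for Q xs and bs :: "bool list"
    by (induction xs arbitrary: bs) auto
  have "ptime e (\<lambda>i. enc_list (map enc_bool (fold (\<lambda>x bs. P i x # bs) (l i) [])))"
  proof (rule ptime_foldI[where ex = ex and ea = "\<lambda>xs. enc_list (map enc_bool xs)" and q = "1 + [:4:] * p", OF l ptime_Nil])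
    fix i ys zs assume "l i = ys @ zs"
    then have "length ys \<le> poly p (tsize (e i))"
      using p[of i] length_le_tsize[of "map ex (l i)"] by simp
    moreover have "tsize (enc_list (map enc_bool (rev (map (P i) ys)))) \<le> 1 + length ys * (1 + 3)"
      by (rule order_trans[OF tsize_enc_list_le[where B = 3]]) (auto simp: tsize_enc_bool)
    ultimately show "tsize (enc_list (map enc_bool (fold (\<lambda>x bs. P i x # bs) ys []))) \<le>
        poly (1 + [:4:] * p) (tsize (e i))" by (simp add: fold)
  next
    fix e' :: "'i \<times> bool list \<times> 'x \<Rightarrow> btree"
    assume *: "\<And>f. ptime e f \<Longrightarrow> ptime e' (\<lambda>j. f (fst j))"
      "ptime e' (\<lambda>j. enc_list (map enc_bool (fst (snd j))))" "ptime e' (\<lambda>j. ex (snd (snd j)))"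
    have body: "ptime e' (\<lambda>j. enc_bool (P (fst j) (snd (snd j))))"
      by (rule ptime_subst[where e = e and ex = ex and f = fst and g = "\<lambda>j. snd (snd j)"
          and h = "\<lambda>i x. enc_bool (P i x)"]) (rule P, assumption+, rule *(1)[OF ptime_id], rule *(3))
    show "ptime e' (\<lambda>j. enc_list (map enc_bool (P (fst j) (snd (snd j)) # fst (snd j))))"
      by (intro ptime_Cons *(2) body)
  qed
  from ptime_rev[OF this] show ?thesis by (simp add: fold)
qed

text \<open>The length of the list built so far is the next number to be put in front.\<close>

lemma ptime_upt:
  fixes e :: "'i \<Rightarrow> btree"
  assumes n: "ptime e (\<lambda>i. un (n i))"
  shows "ptime e (\<lambda>i. enc_list (map un [0..<n i]))"
proof -
  obtain p :: "nat poly" where p: "\<And>i. tsize (un (n i)) \<le> poly p (tsize (e i))"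
    using n by (rule ptime_tsize) blast
  have iter: "((\<lambda>xs. length xs # xs) ^^ m) [] = rev [0..<m]" for m by (induction m) auto
  have "ptime e (\<lambda>i. enc_list (map un (((\<lambda>xs. length xs # xs) ^^ n i) [])))"
  proof (rule ptime_iterate[where ea = "\<lambda>xs. enc_list (map un xs)" and q = "1 + p * (1 + p)", OF n ptime_Nil])
    fix i m assume m: "m \<le> n i"
    have "tsize (enc_list (map un (rev [0..<m]))) \<le> 1 + length (map un (rev [0..<m])) * (1 + (2 * n i + 1))"
      by (rule tsize_enc_list_le) (use m in auto)
    also have "\<dots> \<le> 1 + poly p (tsize (e i)) * (1 + poly p (tsize (e i)))"
      using p[of i] m by (intro add_left_mono mult_le_mono) auto
    finally show "tsize (enc_list (map un (((\<lambda>xs. length xs # xs) ^^ m) []))) \<le> poly (1 + p * (1 + p)) (tsize (e i))"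
      by (simp add: iter)
  next
    fix e' :: "'i \<times> nat list \<Rightarrow> btree"
    assume *: "ptime e' (\<lambda>j. enc_list (map un (snd j)))"
    show "ptime e' (\<lambda>j. enc_list (map un (length (snd j) # snd j)))"
      by (intro ptime_Cons ptime_length * ptime_length[OF *])
  qed
  from ptime_rev[OF this] show ?thesis by (simp add: iter)
qed

definition enc_pair :: "('a \<Rightarrow> btree) \<Rightarrow> ('b \<Rightarrow> btree) \<Rightarrow> 'a \<times> 'b \<Rightarrow> btree" where
  "enc_pair ea eb p = Node (ea (fst p)) (eb (snd p))"

text \<open>Two nested folds share one accumulator. The bound for the inner loop may refer to the
  accumulator at its start, which belongs to its environment \<open>e'\<close>; the bound for the
  outer loop is in terms of \<open>e\<close> alone and rests on the closed form
  \<open>outer\<close>.\<close>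

lemma ptime_product:
  fixes e :: "'i \<Rightarrow> btree" and ex :: "'x \<Rightarrow> btree"
  assumes l: "ptime e (\<lambda>i. enc_list (map ex (l i)))"
  shows "ptime e (\<lambda>i. enc_list (map (enc_pair ex ex) (List.product (l i) (l i))))"
proof -
  obtain p :: "nat poly" where p: "\<And>i. tsize (enc_list (map ex (l i))) \<le> poly p (tsize (e i))"
    using l by (rule ptime_tsize) blast
  let ?ep = "enc_pair ex ex"
  have inner: "fold (\<lambda>y acc. (x, y) # acc) ys acc = rev (map (Pair x) ys) @ acc"
    for x :: 'x and ys :: "'x list" and acc
    by (induction ys arbitrary: acc) auto
  have outer: "fold (\<lambda>x acc. fold (\<lambda>y acc. (x, y) # acc) ys acc) xs acc = rev (List.product xs ys) @ acc"
    for xs ys :: "'x list" and acc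
    by (induction xs arbitrary: acc) (auto simp: inner)
  have size: "tsize (enc_list (map ?ep xs)) \<le> 1 + length xs * (2 + 2 * B)"
    if "\<And>x y. (x, y) \<in> set xs \<Longrightarrow> tsize (ex x) \<le> B \<and> tsize (ex y) \<le> B" for xs B
    by (rule order_trans[OF tsize_enc_list_le[where B = "1 + 2 * B"]])
      (use that in \<open>fastforce simp: enc_pair_def\<close>)+
  have "ptime e (\<lambda>i. enc_list (map ?ep (fold (\<lambda>x acc. fold (\<lambda>y acc. (x, y) # acc) (l i) acc) (l i) [])))"
  proof (rule ptime_foldI[where ex = ex and ea = "\<lambda>xs. enc_list (map ?ep xs)" and q = "1 + p * p * (2 + 2 * p)", OF l ptime_Nil])
    fix i ys zs assume split: "l i = ys @ zs"
    define B where "B = poly p (tsize (e i))"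
    have len: "length (l i) \<le> B" "length ys \<le> B"
      using p[of i] length_le_tsize[of "map ex (l i)"] split by (auto simp: B_def)
    have elem: "tsize (ex x) \<le> B" if "x \<in> set (l i)" for x
      using p[of i] tsize_member[of "ex x" "map ex (l i)"] that by (auto simp: B_def)
    have "tsize (enc_list (map ?ep (rev (List.product ys (l i))))) \<le> 1 + length (rev (List.product ys (l i))) * (2 + 2 * B)"
      by (rule size) (use elem split in auto)
    also have "\<dots> \<le> 1 + B * B * (2 + 2 * B)"
      using len by (intro add_left_mono mult_le_mono) (auto intro: mult_le_mono)
    finally show "tsize (enc_list (map ?ep (fold (\<lambda>x acc. fold (\<lambda>y acc. (x, y) # acc) (l i) acc) ys []))) \<le>
        poly (1 + p * p * (2 + 2 * p)) (tsize (e i))"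
      by (simp add: outer B_def)
  next
    fix e' :: "'i \<times> ('x \<times> 'x) list \<times> 'x \<Rightarrow> btree"
    assume *: "\<And>f. ptime e f \<Longrightarrow> ptime e' (\<lambda>j. f (fst j))"
      "ptime e' (\<lambda>j. enc_list (map ?ep (fst (snd j))))" "ptime e' (\<lambda>j. ex (snd (snd j)))"
    obtain p1 :: "nat poly" where p1: "\<And>j. tsize (enc_list (map ex (l (fst j)))) \<le> poly p1 (tsize (e' j))"
      using *(1)[OF l] by (rule ptime_tsize) blast
    obtain p2 :: "nat poly" where p2: "\<And>j. tsize (enc_list (map ?ep (fst (snd j)))) \<le> poly p2 (tsize (e' j))"
      using *(2) by (rule ptime_tsize) blast
    obtain p3 :: "nat poly" where p3: "\<And>j. tsize (ex (snd (snd j))) \<le> poly p3 (tsize (e' j))"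
      using *(3) by (rule ptime_tsize) blast
    show "ptime e' (\<lambda>j. enc_list (map ?ep (fold (\<lambda>y acc. (snd (snd j), y) # acc) (l (fst j)) (fst (snd j)))))"
    proof (rule ptime_foldI[where ex = ex and ea = "\<lambda>xs. enc_list (map ?ep xs)" and q = "1 + p1 * (2 + 2 * (p1 + p3)) + p2", OF *(1)[OF l] *(2)])
      fix j :: "'i \<times> ('x \<times> 'x) list \<times> 'x" and ys zs assume split: "l (fst j) = ys @ zs"
      define B where "B = poly (p1 + p3) (tsize (e' j))"
      have len: "length ys \<le> poly p1 (tsize (e' j))"
        using p1[of j] length_le_tsize[of "map ex (l (fst j))"] split by auto
      have elem: "tsize (ex x) \<le> B" if "x \<in> set ys" for x
        using p1[of j] tsize_member[of "ex x" "map ex (l (fst j))"] that split by (auto simp: B_def)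
      have "tsize (enc_list (map ?ep (rev (map (Pair (snd (snd j))) ys)))) \<le>
          1 + length (rev (map (Pair (snd (snd j))) ys)) * (2 + 2 * B)"
        by (rule size) (use elem p3[of j] in \<open>auto simp: B_def\<close>)
      also have "\<dots> \<le> 1 + poly p1 (tsize (e' j)) * (2 + 2 * B)"
        using len by (intro add_left_mono mult_le_mono1) simp
      finally show "tsize (enc_list (map ?ep (fold (\<lambda>y acc. (snd (snd j), y) # acc) ys (fst (snd j))))) \<le>
          poly (1 + p1 * (2 + 2 * (p1 + p3)) + p2) (tsize (e' j))"
        using p2[of j] by (simp add: inner tsize_enc_list B_def)
    next
      fix e'' :: "('i \<times> ('x \<times> 'x) list \<times> 'x) \<times> ('x \<times> 'x) list \<times> 'x \<Rightarrow> btree"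
      assume **: "\<And>f. ptime e' f \<Longrightarrow> ptime e'' (\<lambda>j. f (fst j))"
        "ptime e'' (\<lambda>j. enc_list (map ?ep (fst (snd j))))" "ptime e'' (\<lambda>j. ex (snd (snd j)))"
      show "ptime e'' (\<lambda>j. enc_list (map ?ep ((snd (snd (fst j)), snd (snd j)) # fst (snd j))))"
        by (intro ptime_Cons **(2)) (simp add: enc_pair_def ptime_Node **(3) **(1)[OF *(3)])
    qed
  qed
  from ptime_rev[OF this] show ?thesis by (simp add: outer)
qed

section \<open>Capped conversion from binary to unary\<close>

definition bin_val :: "bool list \<Rightarrow> nat" where
  "bin_val bs = foldr (\<lambda>b v. of_bool b + 2 * v) bs 0"

lemma bin_val_binary: "bin_val (binary n) = n"
  by (induction n rule: binary.induct) (subst binary.simps, auto simp: bin_val_def)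

text \<open>The value may be exponential in the number of bits, so it is computed up to a cap.\<close>

definition capped_step :: "nat \<Rightarrow> bool \<Rightarrow> nat \<times> nat \<Rightarrow> nat \<times> nat" where
  "capped_step n b p = (min n (fst p + fst p), if b then min n (snd p + fst p) else snd p)"

text \<open>The pair holds the weight of the current bit and the value read so far, lowest bit
  first. Capping loses nothing, because the cap of a sum depends only on the caps of the
  summands.\<close>

lemma fold_capped_step:
  "fold (capped_step n) bs (min n w, min n a) = (min n (w * 2 ^ length bs), min n (a + w * bin_val bs))"
proof (induction bs arbitrary: w a)
  case (Cons b bs)
  have "capped_step n b (min n w, min n a) = (min n (2 * w), min n (if b then a + w else a))"
    by (auto simp: capped_step_def)
  then show ?case using Cons.IH[of "2 * w" "if b then a + w else a"]
    by (auto simp: bin_val_def algebra_simps)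
qed (simp add: bin_val_def)

lemma ptime_capped_nat:
  fixes e :: "'i \<Rightarrow> btree"
  assumes n: "ptime e (\<lambda>i. un (n i))" and k: "ptime e (\<lambda>i. enc_nat (k i))"
  shows "ptime e (\<lambda>i. un (min (n i) (k i)))"
proof -
  obtain p :: "nat poly" where p: "\<And>i. tsize (un (n i)) \<le> poly p (tsize (e i))"
    using n by (rule ptime_tsize) blast
  have "ptime e (\<lambda>i. enc_pair un un (fold (capped_step (n i)) (binary (k i)) (min (n i) 1, min (n i) 0)))"
  proof (rule ptime_foldI[where ex = enc_bool and ea = "enc_pair un un" and q = "1 + [:2:] * p"])
    show "ptime e (\<lambda>i. enc_list (map enc_bool (binary (k i))))" using k by (simp add: enc_nat_def)
    show "ptime e (\<lambda>i. enc_pair un un (min (n i) 1, min (n i) 0))"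
      unfolding enc_pair_def fst_conv snd_conv One_nat_def by (intro ptime_Node ptime_min n ptime_Suc ptime_0)
    show "tsize (enc_pair un un (fold (capped_step (n i)) ys (min (n i) 1, min (n i) 0))) \<le> poly (1 + [:2:] * p) (tsize (e i))"
      for i ys
      unfolding fold_capped_step using p[of i] by (simp add: enc_pair_def)
  next
    fix e' :: "'i \<times> (nat \<times> nat) \<times> bool \<Rightarrow> btree"
    assume *: "\<And>f. ptime e f \<Longrightarrow> ptime e' (\<lambda>j. f (fst j))"
      "ptime e' (\<lambda>j. enc_pair un un (fst (snd j)))" "ptime e' (\<lambda>j. enc_bool (snd (snd j)))"
    note ab = *(2)[unfolded enc_pair_def]
    show "ptime e' (\<lambda>j. enc_pair un un (capped_step (n (fst j)) (snd (snd j)) (fst (snd j))))"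
      unfolding enc_pair_def capped_step_def fst_conv snd_conv if_distrib[of un]
      by (intro ptime_Node ptime_if ptime_min ptime_add *(3) *(1)[OF n] ptime_fst[OF ab] ptime_snd[OF ab])
  qed
  from ptime_snd[OF this[unfolded enc_pair_def]] show ?thesis
    unfolding fold_capped_step by (simp add: bin_val_binary)
qed


section \<open>Fault-tolerant backbones\<close>

definition greedy_dom :: "('a \<Rightarrow> 'a \<Rightarrow> bool) \<Rightarrow> 'a list \<Rightarrow> nat \<Rightarrow> 'a list" where
  "greedy_dom adj vs c = greedy (\<lambda>H v. length (filter (adj v) H) < c) vs"

text \<open>A pair \<open>(a, b)\<close> stands for the path \<open>u, a, b, v\<close>, and
  \<open>a = b\<close> for the shorter path \<open>u, a, v\<close>. The last three conditions are
  the degree caps and the total cap of the vertex cover kernel.\<close>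

definition conn :: "('a \<Rightarrow> 'a \<Rightarrow> bool) \<Rightarrow> 'a list \<Rightarrow> nat \<Rightarrow> 'a \<Rightarrow> 'a \<Rightarrow> ('a \<times> 'a) list" where
  "conn adj vs k u v = greedy (\<lambda>H h. adj u (fst h) \<and> (fst h = snd h \<or> adj (fst h) (snd h)) \<and>
     adj (snd h) v \<and> length (filter (\<lambda>g. fst g = fst h) H) < k \<and>
     length (filter (\<lambda>g. snd g = snd h) H) < k \<and> length H < 2 * k * k) (List.product vs vs)"

definition backbone :: "('a \<Rightarrow> 'a \<Rightarrow> bool) \<Rightarrow> 'a list \<Rightarrow> nat \<Rightarrow> nat \<Rightarrow> 'a \<Rightarrow> bool" where
  "backbone adj vs k m w \<longleftrightarrow> w \<in> set (greedy_dom adj vs k) \<or> w \<in> set (greedy_dom adj vs m) \<or>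
     (\<exists>u \<in> set (greedy_dom adj vs k). \<exists>v \<in> set (greedy_dom adj vs k). \<exists>h \<in> set (conn adj vs k u v). w = fst h \<or> w = snd h)"

lemma length_filter_card: "distinct xs \<Longrightarrow> length (filter P xs) = card {x \<in> set xs. P x}"
  by (metis distinct_card distinct_filter set_filter)

lemma greedy_dom_subset: "set (greedy_dom adj vs c) \<subseteq> set vs"
  unfolding greedy_dom_def by (rule greedy_subset)

lemma distinct_greedy_dom: "distinct vs \<Longrightarrow> distinct (greedy_dom adj vs c)"
  unfolding greedy_dom_def by (rule distinct_greedy)

text \<open>When \<open>v\<close> was rejected, \<open>c\<close> of its neighbours had been kept,
  and kept nodes stay.\<close>

lemma greedy_dom_dominating:
  assumes "distinct vs" "v \<in> set vs" "v \<notin> set (greedy_dom adj vs c)"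
  shows "c \<le> card {u \<in> set (greedy_dom adj vs c). adj v u}"
proof -
  obtain G H where "greedy_dom adj vs c = G @ H" "\<not> length (filter (adj v) H) < c"
    using greedy_rejected[of v vs "\<lambda>H v. length (filter (adj v) H) < c"] assms
    by (auto simp: greedy_dom_def)
  then have "c \<le> length (filter (adj v) (greedy_dom adj vs c))" by simp
  then show ?thesis using length_filter_card distinct_greedy_dom assms(1) by metis
qed

text \<open>All nodes of \<open>K\<close> kept before a node of \<open>K\<close> are its neighbours,
  so there are fewer than \<open>c\<close> of them when it is kept itself.\<close>

lemma greedy_dom_clique:
  assumes "distinct vs" and K: "\<And>x y. x \<in> K \<Longrightarrow> y \<in> K \<Longrightarrow> x \<noteq> y \<Longrightarrow> adj x y"
  shows "card (set (greedy_dom adj vs c) \<inter> K) \<le> c"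
proof -
  have "length (filter (\<lambda>x. x \<in> K) (greedy_dom adj vs c)) \<le> c"
    unfolding greedy_dom_def using assms(1)
  proof (induction rule: greedy_induct)
    case (Cons H x)
    have "length (filter (\<lambda>x. x \<in> K) H) \<le> length (filter (adj x) H)" if "x \<in> K"
      using Cons(2) K[OF that]
      by (induction H) auto
    then show ?case using Cons by auto
  qed simp
  then show ?thesis
    by (simp add: length_filter_card distinct_greedy_dom assms(1) Int_def)
qed

lemma conn_sound:
  assumes "distinct vs" "h \<in> set (conn adj vs k u v)"
  shows "adj u (fst h) \<and> (fst h = snd h \<or> adj (fst h) (snd h)) \<and> adj (snd h) v \<and>
    fst h \<in> set vs \<and> snd h \<in> set vs"
proof -
  have "\<forall>h \<in> set (conn adj vs k u v). adj u (fst h) \<and> (fst h = snd h \<or> adj (fst h) (snd h)) \<and>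
    adj (snd h) v \<and> fst h \<in> set vs \<and> snd h \<in> set vs"
    unfolding conn_def using distinct_product[OF assms(1) assms(1)]
    by (induction rule: greedy_induct) auto
  then show ?thesis using assms by blast
qed

lemma distinct_conn: "distinct vs \<Longrightarrow> distinct (conn adj vs k u v)"
  unfolding conn_def by (intro distinct_greedy distinct_product)

lemma length_conn:
  assumes "distinct vs"
  shows "length (conn adj vs k u v) \<le> 2 * k * k"
  unfolding conn_def using distinct_product[OF assms assms]
  by (induction rule: greedy_induct) auto

lemma conn_degree:
  assumes "distinct vs"
  shows "length (filter (\<lambda>g. fst g = x) (conn adj vs k u v)) \<le> k \<and>
    length (filter (\<lambda>g. snd g = x) (conn adj vs k u v)) \<le> k"
  unfolding conn_def using distinct_product[OF assms assms]
  by (induction rule: greedy_induct) auto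

text \<open>
  A set of fewer than \<open>k\<close> faults missing the rejected pair \<open>(a, b)\<close> cannot hit all \<open>k\<close> pairs
  that share a node with it; and meeting each node in at most \<open>2k\<close> pairs, it cannot hit all
  pairs of a list of length \<open>2k\<^sup>2\<close>.
\<close>

lemma conn_fault_tolerant:
  assumes "distinct vs" "finite X" "card X < k" "a \<in> set vs" "b \<in> set vs" "a \<notin> X" "b \<notin> X"
    and ab: "adj u a" "a = b \<or> adj a b" "adj b v"
  shows "\<exists>h \<in> set (conn adj vs k u v). fst h \<notin> X \<and> snd h \<notin> X"
proof (cases "(a, b) \<in> set (conn adj vs k u v)")
  case True
  then show ?thesis using assms by force
next
  case False
  then obtain G H where GH: "conn adj vs k u v = G @ H" and
    rej: "\<not> (length (filter (\<lambda>g. fst g = a) H) < k \<and> length (filter (\<lambda>g. snd g = b) H) < k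
      \<and> length H < 2 * k * k)"
    using greedy_rejected[of "(a, b)" "List.product vs vs"] assms unfolding conn_def by fastforce
  have dH: "distinct H" using distinct_conn[OF assms(1)] GH by (metis distinct_append)
  have H: "set H \<subseteq> set (conn adj vs k u v)" using GH by simp
  have deg: "length (filter (\<lambda>g. fst g = x) H) \<le> k" "length (filter (\<lambda>g. snd g = x) H) \<le> k" for x
    using conn_degree[OF assms(1), of x adj k u v] by (auto simp: GH)
  have "\<exists>h \<in> set H. fst h \<notin> X \<and> snd h \<notin> X"
  proof (rule ccontr)
    assume hit: "\<not> ?thesis"
    have "card {h \<in> set H. fst h = a} \<le> card X"
      by (rule card_inj_on_le[of snd]) (use hit assms in \<open>auto simp: inj_on_def prod_eq_iff\<close>)
    moreover have "card {h \<in> set H. snd h = b} \<le> card X"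
      by (rule card_inj_on_le[of fst]) (use hit assms in \<open>auto simp: inj_on_def prod_eq_iff\<close>)
    ultimately have "2 * k * k \<le> card (set H)"
      using rej assms(3) dH by (simp add: length_filter_card distinct_card)
    also have "set H \<subseteq> (\<Union>x\<in>X. {h \<in> set H. fst h = x} \<union> {h \<in> set H. snd h = x})" using hit by auto
    then have "card (set H) \<le> card (\<Union>x\<in>X. {h \<in> set H. fst h = x} \<union> {h \<in> set H. snd h = x})"
      by (intro card_mono) (use assms in auto)
    also have "\<dots> \<le> (\<Sum>x\<in>X. card ({h \<in> set H. fst h = x} \<union> {h \<in> set H. snd h = x}))"
      by (rule card_UN_le) (rule assms)
    also have "\<dots> \<le> (\<Sum>x\<in>X. 2 * k)"
    proof (rule sum_mono)
      fix x
      have "card {h \<in> set H. fst h = x} \<le> k" "card {h \<in> set H. snd h = x} \<le> k"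
        using deg[of x] dH by (simp_all add: length_filter_card)
      then show "card ({h \<in> set H. fst h = x} \<union> {h \<in> set H. snd h = x}) \<le> 2 * k"
        using card_Un_le[of "{h \<in> set H. fst h = x}" "{h \<in> set H. snd h = x}"] by linarith
    qed
    finally have "k * (2 * k) \<le> card X * (2 * k)" by (simp add: ac_simps)
    then show False using assms(3) by simp
  qed
  then show ?thesis using H by blast
qed


section \<open>Connectivity\<close>

text \<open>Nonemptiness matches the convention that the null graph is not connected. Only a binary
  predicate occurs, so the combinatorial part is independent of the graph library.\<close>

definition conn_on :: "('a \<Rightarrow> 'a \<Rightarrow> bool) \<Rightarrow> 'a set \<Rightarrow> bool" where
  "conn_on adj U \<longleftrightarrow> U \<noteq> {} \<and> (\<forall>p\<in>U. \<forall>q\<in>U. (p, q) \<in> {(x, y). x \<in> U \<and> y \<in> U \<and> adj x y}\<^sup>*)"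

text \<open>The nodes of the core \<open>B\<close> have to be joined inside \<open>U\<close> only,
  not inside \<open>B\<close>, which leaves room for connecting nodes outside the core.\<close>

lemma conn_onI:
  assumes "B \<noteq> {}" "B \<subseteq> U" and sym: "\<And>x y. x \<in> U \<Longrightarrow> y \<in> U \<Longrightarrow> adj x y \<Longrightarrow> adj y x"
    and B: "\<And>p q. p \<in> B \<Longrightarrow> q \<in> B \<Longrightarrow> (p, q) \<in> {(x, y). x \<in> U \<and> y \<in> U \<and> adj x y}\<^sup>*"
    and out: "\<And>w. w \<in> U \<Longrightarrow> w \<notin> B \<Longrightarrow> \<exists>b\<in>B. adj w b"
  shows "conn_on adj U"
  unfolding conn_on_def
proof (intro conjI ballI)
  let ?R = "{(x, y). x \<in> U \<and> y \<in> U \<and> adj x y}"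
  show "U \<noteq> {}" using assms by blast
  fix p q assume pq: "p \<in> U" "q \<in> U"
  have near: "\<exists>b\<in>B. (w, b) \<in> ?R\<^sup>* \<and> (b, w) \<in> ?R\<^sup>*" if w: "w \<in> U" for w
  proof (cases "w \<in> B")
    case False
    then obtain b where "b \<in> B" "adj w b" using out w by blast
    then show ?thesis using w assms(2) sym by (blast intro: r_into_rtrancl)
  qed auto
  obtain b b' where "b \<in> B" "(p, b) \<in> ?R\<^sup>*" "b' \<in> B" "(b', q) \<in> ?R\<^sup>*"
    using near pq by meson
  then show "(p, q) \<in> ?R\<^sup>*" using B by (meson rtrancl_trans)
qed

lemma exists_neighbour_outside:
  assumes "finite X" "card X < k" "k \<le> card {u \<in> A. P u}"
  shows "\<exists>u\<in>A. P u \<and> u \<notin> X"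
proof (rule ccontr)
  assume "\<not> ?thesis"
  then have "{u \<in> A. P u} \<subseteq> X" by blast
  then have "card {u \<in> A. P u} \<le> card X" by (rule card_mono[OF assms(1)])
  then show False using assms by linarith
qed

text \<open>A walk in the faulty graph is followed by representatives: each of its nodes is in
  \<open>D - X\<close> or adjacent to a node of \<open>D - X\<close>. Representatives of consecutive
  nodes \<open>w\<close>, \<open>w'\<close> are ends of the path \<open>d, w, w', d'\<close>, which
  kept pairs can replace.\<close>

lemma backbone_connected:
  assumes vs: "distinct vs" "finite X" "card X < k" "X \<subseteq> set vs"
    and sym: "\<And>x y. x \<in> set vs \<Longrightarrow> y \<in> set vs \<Longrightarrow> adj x y \<Longrightarrow> adj y x"
    and V: "conn_on adj (set vs - X)" and proper: "set (greedy_dom adj vs k) \<noteq> set vs"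
  shows "conn_on adj ({w \<in> set vs. backbone adj vs k m w} - X)"
proof -
  define D where "D = set (greedy_dom adj vs k)"
  define U where "U = {w \<in> set vs. backbone adj vs k m w} - X"
  let ?R = "{(x, y). x \<in> U \<and> y \<in> U \<and> adj x y}"
  have D: "D \<subseteq> set vs" "D - X \<subseteq> U"
    using greedy_dom_subset[of adj vs k] by (auto simp: D_def U_def backbone_def)
  have near: "\<exists>d\<in>D - X. adj w d" if "w \<in> set vs" "w \<notin> D" for w
    using exists_neighbour_outside[OF vs(2,3) greedy_dom_dominating[OF vs(1) that[unfolded D_def]]]
    by (auto simp: D_def)
  have near': "\<exists>d\<in>D - X. d = w \<or> adj d w" if "w \<in> set vs - X" for w
    using near[of w] that sym D by (cases "w \<in> D") blast+
  \<comment> \<open>The nodes \<open>a\<close> and \<open>b\<close> may lie outside the backbone.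
    They only witness that a fault-free path exists, so that some kept pair is fault-free
    too.\<close>
  have hop: "(d, d') \<in> ?R\<^sup>*" if d: "d \<in> D - X" "d' \<in> D - X" and
    ab: "a \<in> set vs - X" "b \<in> set vs - X" "adj d a" "a = b \<or> adj a b" "adj b d'" for d d' a b
  proof -
    obtain a' b' where h: "(a', b') \<in> set (conn adj vs k d d')" "a' \<notin> X" "b' \<notin> X"
      using conn_fault_tolerant[of vs X k a b adj d d'] vs ab by fastforce
    note s = conn_sound[OF vs(1) h(1), simplified]
    have "a' \<in> U" "b' \<in> U" using h s d by (force simp: U_def D_def backbone_def)+
    then have "(d, a') \<in> ?R" "a' = b' \<or> (a', b') \<in> ?R" "(b', d') \<in> ?R" using s d D by auto
    then show ?thesis by (meson converse_rtrancl_into_rtrancl r_into_rtrancl)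
  qed
  \<comment> \<open>If exactly one of \<open>w\<close>, \<open>w'\<close> is its own representative,
    the path has a single inner node and is handled as a pair with equal components.\<close>
  have link: "(d, d') \<in> ?R\<^sup>*" if d: "d \<in> D - X" "d' \<in> D - X" and
    w: "w \<in> set vs - X" "w' \<in> set vs - X" "adj w w'" "d = w \<or> adj d w" "d' = w' \<or> adj d' w'" for d d' w w'
  proof -
    have "adj w' d'" if "d' \<noteq> w'" using w d D sym that by blast
    then consider "d = w" "d' = w'" | "d = w" "adj w' d'" | "adj d w" "d' = w'" | "adj d w" "adj w' d'"
      using w by blast
    then show ?thesis
    proof cases
      case 1
      then have "(d, d') \<in> ?R" using d D w by auto
      then show ?thesis by blast
    next
      case 2
      then show ?thesis using hop[OF d w(2) w(2)] w by simp
    next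
      case 3
      then show ?thesis using hop[OF d w(1) w(1)] w by simp
    next
      case 4
      then show ?thesis using hop[OF d w(1) w(2)] w by simp
    qed
  qed
  have "conn_on adj U"
  proof (rule conn_onI)
    \<comment> \<open>A node outside \<open>D\<close> has \<open>k\<close> neighbours in
      \<open>D\<close>, too many for \<open>X\<close> to contain; so \<open>D - X\<close> is not
      empty.\<close>
    obtain w where "w \<in> set vs" "w \<notin> D" using D proper by (auto simp: D_def)
    then show "D - X \<noteq> {}" using near by blast
    show "D - X \<subseteq> U" by (rule D)
    show "adj y x" if "x \<in> U" "y \<in> U" "adj x y" for x y using that sym by (auto simp: U_def)
    show "\<exists>b\<in>D - X. adj w b" if "w \<in> U" "w \<notin> D - X" for w
      using near[of w] that by (auto simp: U_def)
    fix p q assume pq: "p \<in> D - X" "q \<in> D - X"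
    then have "(p, q) \<in> {(x, y). x \<in> set vs - X \<and> y \<in> set vs - X \<and> adj x y}\<^sup>*"
      using V D unfolding conn_on_def by blast
    \<comment> \<open>Induction along the walk, with \<open>p\<close> joined inside the backbone to
      a representative of the current node.\<close>
    then have "\<exists>d\<in>D - X. (d = q \<or> adj d q) \<and> (p, d) \<in> ?R\<^sup>*"
    proof (induction rule: rtrancl_induct)
      case base
      then show ?case using pq by blast
    next
      case (step y z)
      then obtain d where d: "d \<in> D - X" "d = y \<or> adj d y" "(p, d) \<in> ?R\<^sup>*" by blast
      obtain d' where d': "d' \<in> D - X" "d' = z \<or> adj d' z" using near'[of z] step.hyps by blast
      have "(d, d') \<in> ?R\<^sup>*"
        by (rule link[OF d(1) d'(1) _ _ _ d(2) d'(2)]) (use step.hyps in auto)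
      with d(3) have "(p, d') \<in> ?R\<^sup>*" by (rule rtrancl_trans)
      then show ?case using d' by blast
    qed
    then obtain d where d: "d \<in> D - X" "d = q \<or> adj d q" "(p, d) \<in> ?R\<^sup>*" by blast
    have "(d, q) \<in> ?R\<^sup>*"
    proof (cases "d = q")
      case False
      then have "(d, q) \<in> ?R" using d pq D by auto
      then show ?thesis by blast
    qed simp
    then show "(p, q) \<in> ?R\<^sup>*" using d by (meson rtrancl_trans)
  qed
  then show ?thesis by (simp add: U_def)
qed


section \<open>Packing in unit disk graphs\<close>

locale unit_disk =
  fixes vs :: "'a list" and adj :: "'a \<Rightarrow> 'a \<Rightarrow> bool" and pos :: "'a \<Rightarrow> real ^ 2"
  assumes distinct: "distinct vs"
    and irrefl: "u \<in> set vs \<Longrightarrow> \<not> adj u u"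
    and adj_iff: "u \<in> set vs \<Longrightarrow> v \<in> set vs \<Longrightarrow> u \<noteq> v \<Longrightarrow> adj u v \<longleftrightarrow> dist (pos u) (pos v) \<le> 1"
begin

lemma sym: "u \<in> set vs \<Longrightarrow> v \<in> set vs \<Longrightarrow> adj u v \<Longrightarrow> adj v u"
  using adj_iff[of u v] adj_iff[of v u] irrefl by (metis dist_commute)

lemma adj_dist: "u \<in> set vs \<Longrightarrow> v \<in> set vs \<Longrightarrow> adj u v \<Longrightarrow> dist (pos u) (pos v) \<le> 1"
  using adj_iff irrefl by metis

text \<open>The grid has side length one half, so that every cell has diameter less than one.\<close>

definition cell :: "'a \<Rightarrow> 'a \<Rightarrow> int \<times> int" where
  "cell u w = (\<lfloor>2 * (pos w $ 1 - pos u $ 1)\<rfloor>, \<lfloor>2 * (pos w $ 2 - pos u $ 2)\<rfloor>)"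

text \<open>Each coordinate differs by less than 1/2, so even the sum of the two differences is
  below 1.\<close>

lemma adj_same_cell:
  assumes "w \<in> set vs" "x \<in> set vs" "w \<noteq> x" "cell u w = cell u x"
  shows "adj w x"
proof -
  have floor_eq: "\<bar>a - b\<bar> < 1 / 2" if "\<lfloor>2 * a\<rfloor> = \<lfloor>2 * b\<rfloor>" for a b :: real
    using that by linarith
  have "\<bar>pos w $ 1 - pos x $ 1\<bar> < 1 / 2" "\<bar>pos w $ 2 - pos x $ 2\<bar> < 1 / 2"
    using floor_eq[of "pos w $ 1 - pos u $ 1" "pos x $ 1 - pos u $ 1"]
      floor_eq[of "pos w $ 2 - pos u $ 2" "pos x $ 2 - pos u $ 2"] assms(4) by (auto simp: cell_def)
  moreover have "dist (pos w) (pos x) \<le> \<bar>pos w $ 1 - pos x $ 1\<bar> + \<bar>pos w $ 2 - pos x $ 2\<bar>"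
    using norm_le_l1_cart[of "pos w - pos x"] by (simp add: dist_norm sum_2)
  ultimately show ?thesis using adj_iff assms by simp
qed

text \<open>The grid is anchored at \<open>u\<close>. The floor reaches the extreme value
  \<open>2 * r\<close> on the boundary, hence \<open>4 * r + 1\<close> values per
  coordinate.\<close>

lemma cell_range:
  assumes "dist (pos u) (pos w) \<le> real r"
  shows "cell u w \<in> {-2 * int r..2 * int r} \<times> {-2 * int r..2 * int r}"
proof -
  have "\<bar>pos w $ i - pos u $ i\<bar> \<le> real r" for i
    using component_le_norm_cart[of "pos w - pos u" i] assms
    by (simp add: dist_norm norm_minus_commute)
  from this[of 1] this[of 2] show ?thesis
    by (auto simp: cell_def le_floor_iff floor_le_iff abs_le_iff)
qed

lemma card_near:
  assumes A: "A \<subseteq> set vs"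
    and K: "\<And>K. (\<And>x y. x \<in> K \<Longrightarrow> y \<in> K \<Longrightarrow> x \<noteq> y \<Longrightarrow> adj x y) \<Longrightarrow> card (A \<inter> K) \<le> c"
  shows "card {w \<in> A. dist (pos u) (pos w) \<le> real r} \<le> (4 * r + 1)\<^sup>2 * c"
proof -
  let ?I = "{-2 * int r..2 * int r} \<times> {-2 * int r..2 * int r}"
  have fin: "finite A" using A finite_subset by blast
  have "{w \<in> A. dist (pos u) (pos w) \<le> real r} \<subseteq> (\<Union>i\<in>?I. A \<inter> {w \<in> set vs. cell u w = i})"
    using A cell_range by fastforce
  then have "card {w \<in> A. dist (pos u) (pos w) \<le> real r} \<le> card (\<Union>i\<in>?I. A \<inter> {w \<in> set vs. cell u w = i})"
    by (intro card_mono) (use fin in auto)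
  also have "\<dots> \<le> (\<Sum>i\<in>?I. card (A \<inter> {w \<in> set vs. cell u w = i}))"
    by (intro card_UN_le) auto
  also have "\<dots> \<le> of_nat (card ?I) * c"
    by (intro sum_bounded_above K) (auto intro: adj_same_cell[where u = u])
  finally have le: "card {w \<in> A. dist (pos u) (pos w) \<le> real r} \<le> card ?I * c" by simp
  have "nat (2 * int r - - 2 * int r + 1) = 4 * r + 1" by linarith
  then have "card ?I = (4 * r + 1)\<^sup>2"
    by (simp only: card_cartesian_product card_atLeastAtMost_int power2_eq_square)
  with le show ?thesis by (simp only:)
qed

lemma card_greedy_dom_near:
  "card {w \<in> set (greedy_dom adj vs c). dist (pos u) (pos w) \<le> real r} \<le> (4 * r + 1)\<^sup>2 * c"
  by (intro card_near greedy_dom_subset greedy_dom_clique distinct)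

text \<open>Adjacent pairs between \<open>?A - T\<close> and \<open>T\<close> are counted: at least
  \<open>c\<close> per node of \<open>?A - T\<close>, and at most \<open>25 * c\<close> per node of
  \<open>T\<close>, where 25 is the number of cells for \<open>r = 1\<close>. The factor
  \<open>c\<close> cancels; the 26th copy of \<open>card T\<close> pays for the nodes of
  \<open>T\<close> itself.\<close>

lemma card_greedy_dom:
  assumes T: "T \<subseteq> set vs" and dom: "\<And>v. v \<in> set vs \<Longrightarrow> v \<notin> T \<Longrightarrow> c \<le> card {u \<in> T. adj v u}"
    and c: "0 < c"
  shows "card (set (greedy_dom adj vs c)) \<le> 26 * card T"
proof -
  let ?A = "set (greedy_dom adj vs c)"
  have fin: "finite T" using T finite_subset by blast
  have A: "?A \<subseteq> set vs" by (rule greedy_dom_subset)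
  have "card (?A - T) * c = (\<Sum>v\<in>?A - T. c)" by simp
  also have "\<dots> \<le> (\<Sum>v\<in>?A - T. card {u \<in> T. adj v u})"
    using dom A by (intro sum_mono) auto
  also have "\<dots> = (\<Sum>v\<in>?A - T. \<Sum>u\<in>T. if adj v u then 1 else 0)"
    using fin by (simp add: sum.If_cases Int_def)
  also have "\<dots> = (\<Sum>u\<in>T. \<Sum>v\<in>?A - T. if adj v u then 1 else 0)" by (rule sum.swap)
  also have "\<dots> \<le> (\<Sum>u\<in>T. 25 * c)"
  proof (rule sum_mono)
    fix u assume u: "u \<in> T"
    have "(\<Sum>v\<in>?A - T. if adj v u then 1 else 0) = card {v \<in> ?A - T. adj v u}"
      by (simp add: sum.If_cases Int_def)
    also have "\<dots> \<le> card {w \<in> ?A. dist (pos u) (pos w) \<le> real 1}"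
      using adj_dist A T u by (intro card_mono) (auto simp: dist_commute)
    also have "\<dots> \<le> (4 * 1 + 1)\<^sup>2 * c" by (rule card_greedy_dom_near)
    finally show "(\<Sum>v\<in>?A - T. if adj v u then 1 else 0) \<le> 25 * c" by simp
  qed
  finally have "card (?A - T) * c \<le> (25 * card T) * c" by (simp only: sum_constant of_nat_id ac_simps)
  then have "card (?A - T) \<le> 25 * card T" using c mult_le_cancel2[of _ c] by blast
  moreover have "card ?A \<le> card (?A - T) + card T"
    using card_Un_le[of "?A - T" T] card_mono[of "(?A - T) \<union> T" ?A] fin by fastforce
  ultimately show ?thesis by simp
qed

text \<open>A kept pair is a path of at most three edges. Hence only nearby pairs of dominators
  contribute connecting nodes.\<close>

lemma conn_dist:
  assumes "u \<in> set vs" "v \<in> set vs" "h \<in> set (conn adj vs k u v)"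
  shows "dist (pos u) (pos v) \<le> real 3"
proof -
  note s = conn_sound[OF distinct assms(3)]
  have "dist (pos u) (pos (fst h)) \<le> 1" "dist (pos (snd h)) (pos v) \<le> 1"
    using s assms adj_dist by auto
  moreover have "dist (pos (fst h)) (pos (snd h)) \<le> 1"
    using s adj_dist by (cases "fst h = snd h") auto
  ultimately show ?thesis
    using dist_triangle[of "pos u" "pos v" "pos (fst h)"]
      dist_triangle[of "pos (fst h)" "pos v" "pos (snd h)"] by simp
qed

text \<open>There are \<open>13\<^sup>2 = 169\<close> cells for \<open>r = 3\<close>, so each
  dominator has at most \<open>169 * k\<close> partners. Each partner brings at most
  \<open>2 * k * k\<close> pairs, that is \<open>4 * k * k\<close> nodes, and
  \<open>676 = 169 * 4\<close>.\<close>

lemma card_backbone: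
  "card {w \<in> set vs. backbone adj vs k m w} \<le>
    card (set (greedy_dom adj vs m)) + card (set (greedy_dom adj vs k)) * (1 + 676 * k ^ 3)"
proof -
  let ?D = "set (greedy_dom adj vs k)" and ?M = "set (greedy_dom adj vs m)"
  define N where "N u = {v \<in> ?D. dist (pos u) (pos v) \<le> real 3}" for u
  define E where "E u v = fst ` set (conn adj vs k u v) \<union> snd ` set (conn adj vs k u v)" for u v
  have E: "card (E u v) \<le> 4 * k\<^sup>2" for u v
  proof -
    have "card (set (conn adj vs k u v)) \<le> 2 * k\<^sup>2"
      using card_length[of "conn adj vs k u v"] length_conn[OF distinct, of adj k u v]
      by (simp add: power2_eq_square)
    moreover have "card (fst ` set (conn adj vs k u v)) \<le> card (set (conn adj vs k u v))"
      "card (snd ` set (conn adj vs k u v)) \<le> card (set (conn adj vs k u v))"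
      by (simp_all add: card_image_le)
    ultimately show ?thesis
      unfolding E_def
      using card_Un_le[of "fst ` set (conn adj vs k u v)" "snd ` set (conn adj vs k u v)"] by linarith
  qed
  have N: "card (N u) \<le> 169 * k" for u
    using card_greedy_dom_near[of k u 3] by (simp add: N_def)
  have fin: "finite (N u)" "finite (E u v)" for u v by (auto simp: N_def E_def)
  have "{w \<in> set vs. backbone adj vs k m w} \<subseteq> ?M \<union> (?D \<union> (\<Union>u\<in>?D. \<Union>v\<in>N u. E u v))"
  proof
    fix w assume "w \<in> {w \<in> set vs. backbone adj vs k m w}"
    then consider "w \<in> ?D" | "w \<in> ?M"
      | u v h where "u \<in> ?D" "v \<in> ?D" "h \<in> set (conn adj vs k u v)" "w = fst h \<or> w = snd h"
      by (auto simp: backbone_def)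
    then show "w \<in> ?M \<union> (?D \<union> (\<Union>u\<in>?D. \<Union>v\<in>N u. E u v))"
    proof cases
      case 3
      then have "v \<in> N u" "w \<in> E u v"
        using conn_dist[of u v h k] greedy_dom_subset[of adj vs k] by (auto simp: N_def E_def)
      then show ?thesis using 3 by blast
    qed auto
  qed
  then have "card {w \<in> set vs. backbone adj vs k m w} \<le> card (?M \<union> (?D \<union> (\<Union>u\<in>?D. \<Union>v\<in>N u. E u v)))"
    by (intro card_mono) (use fin in auto)
  also have "\<dots> \<le> card ?M + (card ?D + card (\<Union>u\<in>?D. \<Union>v\<in>N u. E u v))"
    by (meson add_left_mono card_Un_le order_trans)
  also have "card (\<Union>u\<in>?D. \<Union>v\<in>N u. E u v) \<le> (\<Sum>u\<in>?D. card (\<Union>v\<in>N u. E u v))"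
    by (intro card_UN_le) simp
  also have "\<dots> \<le> of_nat (card ?D) * (169 * k * (4 * k\<^sup>2))"
  proof (rule sum_bounded_above)
    fix u
    have "card (\<Union>v\<in>N u. E u v) \<le> (\<Sum>v\<in>N u. card (E u v))" by (intro card_UN_le fin)
    also have "\<dots> \<le> of_nat (card (N u)) * (4 * k\<^sup>2)" by (intro sum_bounded_above E)
    also have "\<dots> \<le> 169 * k * (4 * k\<^sup>2)" using N[of u] by simp
    finally show "card (\<Union>v\<in>N u. E u v) \<le> 169 * k * (4 * k\<^sup>2)" .
  qed
  finally show ?thesis by (simp add: algebra_simps power3_eq_cube power2_eq_square)
qed

end


section \<open>The algorithm runs in polynomial time\<close>

text \<open>Both defaults, \<open>False\<close> and the empty row, are encoded by
  \<open>Leaf\<close>, as needed to look up entries of encoded lists.\<close>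

definition adjm :: "bool list list \<Rightarrow> nat \<Rightarrow> nat \<Rightarrow> bool" where
  "adjm M a b = nth_default False (nth_default [] M a) b"

definition enc_matrix :: "bool list list \<Rightarrow> btree" where
  "enc_matrix M = enc_list (map (\<lambda>r. enc_list (map enc_bool r)) M)"

lemma ptime_adjm:
  assumes "ptime e (\<lambda>i. enc_matrix (M i))" "ptime e (\<lambda>i. un (a i))" "ptime e (\<lambda>i. un (b i))"
  shows "ptime e (\<lambda>i. enc_bool (adjm (M i) (a i) (b i)))"
proof -
  have "ptime e (\<lambda>i. enc_list (map enc_bool (nth_default [] (M i) (a i))))"
    by (rule ptime_nth_default[where ex = "\<lambda>r. enc_list (map enc_bool r)"])
      (use assms in \<open>simp_all add: enc_matrix_def\<close>)
  then show ?thesis unfolding adjm_def by (rule ptime_nth_default) (rule assms(3), simp)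
qed

context
  fixes e :: "'i \<Rightarrow> btree" and M :: "'i \<Rightarrow> bool list list" and vs :: "'i \<Rightarrow> nat list"
    and k m :: "'i \<Rightarrow> nat"
  assumes M: "ptime e (\<lambda>i. enc_matrix (M i))"
    and vs: "ptime e (\<lambda>i. enc_list (map un (vs i)))"
    and k: "ptime e (\<lambda>i. un (k i))" and m: "ptime e (\<lambda>i. un (m i))"
begin

lemma ptime_greedy_dom:
  assumes c: "ptime e (\<lambda>i. un (c i))"
  shows "ptime e (\<lambda>i. enc_list (map un (greedy_dom (adjm (M i)) (vs i) (c i))))"
  unfolding greedy_dom_def
proof (rule ptime_greedy[OF vs])
  fix e' :: "'i \<times> nat list \<times> nat \<Rightarrow> btree"
  assume *: "\<And>f. ptime e f \<Longrightarrow> ptime e' (\<lambda>j. f (fst j))"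
    "ptime e' (\<lambda>j. enc_list (map un (fst (snd j))))" "ptime e' (\<lambda>j. un (snd (snd j)))"
  show "ptime e' (\<lambda>j. enc_bool (length (filter (adjm (M (fst j)) (snd (snd j))) (fst (snd j))) < c (fst j)))"
  proof (rule ptime_count_less[OF *(2) *(1)[OF c]])
    fix e'' :: "('i \<times> nat list \<times> nat) \<times> nat \<Rightarrow> btree"
    assume **: "\<And>f. ptime e' f \<Longrightarrow> ptime e'' (\<lambda>j. f (fst j))" "ptime e'' (\<lambda>j. un (snd j))"
    show "ptime e'' (\<lambda>j. enc_bool (adjm (M (fst (fst j))) (snd (snd (fst j))) (snd j)))"
      by (rule ptime_adjm[OF **(1)[OF *(1)[OF M]] **(1)[OF *(3)] **(2)])
  qed
qed

text \<open>The nodes \<open>u\<close> and \<open>v\<close> are bound by quantifiers in the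
  backbone, so they live in a larger environment \<open>d\<close>, from which \<open>h\<close>
  recovers the instance.\<close>

lemma ptime_conn:
  fixes d :: "'j \<Rightarrow> btree"
  assumes d: "\<And>f. ptime e f \<Longrightarrow> ptime d (\<lambda>j. f (h j))"
    and u: "ptime d (\<lambda>j. un (u j))" and v: "ptime d (\<lambda>j. un (v j))"
  shows "ptime d (\<lambda>j. enc_list (map (enc_pair un un) (conn (adjm (M (h j))) (vs (h j)) (k (h j)) (u j) (v j))))"
  unfolding conn_def
proof (rule ptime_greedy[OF ptime_product[OF d[OF vs]]])
  fix e' :: "'j \<times> (nat \<times> nat) list \<times> nat \<times> nat \<Rightarrow> btree"
  assume *: "\<And>f. ptime d f \<Longrightarrow> ptime e' (\<lambda>j. f (fst j))"
    "ptime e' (\<lambda>j. enc_list (map (enc_pair un un) (fst (snd j))))"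
    "ptime e' (\<lambda>j. enc_pair un un (snd (snd j)))"
  note ab = ptime_fst[OF *(3)[unfolded enc_pair_def]] ptime_snd[OF *(3)[unfolded enc_pair_def]]
  note k' = *(1)[OF d[OF k]] and M' = *(1)[OF d[OF M]]
  have fst: "ptime e' (\<lambda>j. enc_bool (length (filter (\<lambda>g. fst g = fst (snd (snd j))) (fst (snd j))) < k (h (fst j))))"
  proof (rule ptime_count_less[OF *(2) k'])
    fix e'' :: "('j \<times> (nat \<times> nat) list \<times> nat \<times> nat) \<times> nat \<times> nat \<Rightarrow> btree"
    assume **: "\<And>f. ptime e' f \<Longrightarrow> ptime e'' (\<lambda>j. f (fst j))" "ptime e'' (\<lambda>j. enc_pair un un (snd j))"
    show "ptime e'' (\<lambda>j. enc_bool (fst (snd j) = fst (snd (snd (fst j)))))"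
      by (rule ptime_eq[OF ptime_fst[OF **(2)[unfolded enc_pair_def]] **(1)[OF ab(1)]])
  qed
  have snd: "ptime e' (\<lambda>j. enc_bool (length (filter (\<lambda>g. snd g = snd (snd (snd j))) (fst (snd j))) < k (h (fst j))))"
  proof (rule ptime_count_less[OF *(2) k'])
    fix e'' :: "('j \<times> (nat \<times> nat) list \<times> nat \<times> nat) \<times> nat \<times> nat \<Rightarrow> btree"
    assume **: "\<And>f. ptime e' f \<Longrightarrow> ptime e'' (\<lambda>j. f (fst j))" "ptime e'' (\<lambda>j. enc_pair un un (snd j))"
    show "ptime e'' (\<lambda>j. enc_bool (snd (snd j) = snd (snd (snd (fst j)))))"
      by (rule ptime_eq[OF ptime_snd[OF **(2)[unfolded enc_pair_def]] **(1)[OF ab(2)]])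
  qed
  have two: "ptime e' (\<lambda>j. un 2)"
    using ptime_Suc[OF ptime_Suc[OF ptime_0]] by (simp add: numeral_2_eq_2)
  show "ptime e' (\<lambda>j. enc_bool (adjm (M (h (fst j))) (u (fst j)) (fst (snd (snd j))) \<and>
      (fst (snd (snd j)) = snd (snd (snd j)) \<or>
       adjm (M (h (fst j))) (fst (snd (snd j))) (snd (snd (snd j)))) \<and>
      adjm (M (h (fst j))) (snd (snd (snd j))) (v (fst j)) \<and>
      length (filter (\<lambda>g. fst g = fst (snd (snd j))) (fst (snd j))) < k (h (fst j)) \<and>
      length (filter (\<lambda>g. snd g = snd (snd (snd j))) (fst (snd j))) < k (h (fst j)) \<and>
      length (fst (snd j)) < 2 * k (h (fst j)) * k (h (fst j))))"
    by (intro ptime_conj ptime_disj fst snd ptime_eq ab ptime_adjm M' *(1)[OF u] *(1)[OF v]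
        ptime_less ptime_length[OF *(2)] ptime_mult two k')
qed

text \<open>Every quantifier adds one variable to the environment, from \<open>e1\<close> up to
  \<open>e4\<close>. Lists are recomputed wherever they are used, at the price of a polynomial
  factor.\<close>

lemma ptime_backbone:
  "ptime e (\<lambda>i. enc_list (map enc_bool (map (backbone (adjm (M i)) (vs i) (k i) (m i)) (rev (vs i)))))"
proof (rule ptime_map_bool[OF ptime_rev[OF vs]])
  fix e1 :: "'i \<times> nat \<Rightarrow> btree"
  assume 1: "\<And>f. ptime e f \<Longrightarrow> ptime e1 (\<lambda>j. f (fst j))" "ptime e1 (\<lambda>j. un (snd j))"
  note D = ptime_greedy_dom[OF k] and D' = ptime_greedy_dom[OF m]
  have mem: "ptime e1 (\<lambda>j. enc_bool (snd j \<in> set (greedy_dom (adjm (M (fst j))) (vs (fst j)) (c (fst j)))))"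
    if "ptime e (\<lambda>i. enc_list (map un (greedy_dom (adjm (M i)) (vs i) (c i))))" for c
  proof -
    have "ptime e1 (\<lambda>j. enc_bool (\<exists>x \<in> set (greedy_dom (adjm (M (fst j))) (vs (fst j)) (c (fst j))). snd j = x))"
    proof (rule ptime_Bex[OF 1(1)[OF that]])
      fix e2 :: "('i \<times> nat) \<times> nat \<Rightarrow> btree"
      assume 2: "\<And>f. ptime e1 f \<Longrightarrow> ptime e2 (\<lambda>j. f (fst j))" "ptime e2 (\<lambda>j. un (snd j))"
      show "ptime e2 (\<lambda>j. enc_bool (snd (fst j) = snd j))"
        by (rule ptime_eq[OF 2(1)[OF 1(2)] 2(2)])
    qed
    then show ?thesis by simp
  qed
  have ex: "ptime e1 (\<lambda>j. enc_bool (\<exists>u \<in> set (greedy_dom (adjm (M (fst j))) (vs (fst j)) (k (fst j))).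
      \<exists>v \<in> set (greedy_dom (adjm (M (fst j))) (vs (fst j)) (k (fst j))).
      \<exists>h \<in> set (conn (adjm (M (fst j))) (vs (fst j)) (k (fst j)) u v). snd j = fst h \<or> snd j = snd h))"
  proof (rule ptime_Bex[OF 1(1)[OF D]])
    fix e2 :: "('i \<times> nat) \<times> nat \<Rightarrow> btree"
    assume 2: "\<And>f. ptime e1 f \<Longrightarrow> ptime e2 (\<lambda>j. f (fst j))" "ptime e2 (\<lambda>j. un (snd j))"
    show "ptime e2 (\<lambda>j. enc_bool (\<exists>v \<in> set (greedy_dom (adjm (M (fst (fst j)))) (vs (fst (fst j))) (k (fst (fst j)))).
      \<exists>h \<in> set (conn (adjm (M (fst (fst j)))) (vs (fst (fst j))) (k (fst (fst j))) (snd j) v).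
      snd (fst j) = fst h \<or> snd (fst j) = snd h))"
    proof (rule ptime_Bex[OF 2(1)[OF 1(1)[OF D]]])
      fix e3 :: "(('i \<times> nat) \<times> nat) \<times> nat \<Rightarrow> btree"
      assume 3: "\<And>f. ptime e2 f \<Longrightarrow> ptime e3 (\<lambda>j. f (fst j))" "ptime e3 (\<lambda>j. un (snd j))"
      have C: "ptime e3 (\<lambda>j. enc_list (map (enc_pair un un) (conn (adjm (M (fst (fst (fst j)))))
          (vs (fst (fst (fst j)))) (k (fst (fst (fst j)))) (snd (fst j)) (snd j))))"
        by (rule ptime_conn[where h = "\<lambda>j. fst (fst (fst j))"]) (rule 3(1)[OF 2(1)[OF 1(1)]],
          assumption, rule 3(1)[OF 2(2)], rule 3(2))
      show "ptime e3 (\<lambda>j. enc_bool (\<exists>h \<in> set (conn (adjm (M (fst (fst (fst j))))) (vs (fst (fst (fst j))))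
          (k (fst (fst (fst j)))) (snd (fst j)) (snd j)). snd (fst (fst j)) = fst h \<or> snd (fst (fst j)) = snd h))"
      proof (rule ptime_Bex[OF C])
        fix e4 :: "((('i \<times> nat) \<times> nat) \<times> nat) \<times> nat \<times> nat \<Rightarrow> btree"
        assume 4: "\<And>f. ptime e3 f \<Longrightarrow> ptime e4 (\<lambda>j. f (fst j))" "ptime e4 (\<lambda>j. enc_pair un un (snd j))"
        note ab = 4(2)[unfolded enc_pair_def]
        show "ptime e4 (\<lambda>j. enc_bool (snd (fst (fst (fst j))) = fst (snd j) \<or> snd (fst (fst (fst j))) = snd (snd j)))"
          by (intro ptime_disj ptime_eq ptime_fst[OF ab] ptime_snd[OF ab] 4(1)[OF 3(1)[OF 2(1)[OF 1(2)]]])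
      qed
    qed
  qed
  show "ptime e1 (\<lambda>j. enc_bool (backbone (adjm (M (fst j))) (vs (fst j)) (k (fst j)) (m (fst j)) (snd j)))"
    unfolding backbone_def by (intro ptime_disj mem D D' ex)
qed

end

definition adj_matrix :: "'a list \<Rightarrow> 'a pair_pre_digraph \<Rightarrow> bool list list" where
  "adj_matrix vs G = map (\<lambda>u. map (\<lambda>v. (u, v) \<in> parcs G) vs) vs"

text \<open>The program knows nodes as indices only. It scans them in descending order and emits the
  membership bits in ascending order, as \<open>enc_set\<close> lists them.\<close>

definition solution :: "'a list \<Rightarrow> 'a pair_pre_digraph \<Rightarrow> nat \<Rightarrow> nat \<Rightarrow> bool list" where
  "solution vs G k m = (let n = length vs in
     map (backbone (adjm (adj_matrix vs G)) (rev [0..<n]) (min n k) (min n m)) [0..<n])"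

lemma ptime_solution:
  "ptime (\<lambda>(G, vs, k, m). enc_instance vs G k m)
    (\<lambda>(G, vs, k, m). enc_list (map enc_bool (solution vs G k m)))"
  (is "ptime ?e _")
proof -
  let ?G = "fst" and ?vs = "\<lambda>i. fst (snd i)" and ?k = "\<lambda>i. fst (snd (snd i))" and ?m = "\<lambda>i. snd (snd (snd i))"
  have id: "ptime ?e (\<lambda>i. Node (enc_graph (?vs i) (?G i)) (Node (enc_nat (?k i)) (Node (enc_nat (?m i)) Leaf)))"
    using ptime_id[of ?e] by (simp add: enc_instance_def case_prod_beta')
  note G = ptime_fst[OF id] and k = ptime_fst[OF ptime_snd[OF id]]
    and m = ptime_fst[OF ptime_snd[OF ptime_snd[OF id]]]
  have M: "ptime ?e (\<lambda>i. enc_matrix (adj_matrix (?vs i) (?G i)))"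
    using G by (simp add: enc_graph_def enc_matrix_def adj_matrix_def o_def)
  have n: "ptime ?e (\<lambda>i. un (length (?vs i)))"
    using ptime_length[OF M[unfolded enc_matrix_def]] by (simp add: adj_matrix_def)
  have "ptime ?e (\<lambda>i. enc_list (map enc_bool (map (backbone (adjm (adj_matrix (?vs i) (?G i)))
      (rev [0..<length (?vs i)]) (min (length (?vs i)) (?k i)) (min (length (?vs i)) (?m i)))
      (rev (rev [0..<length (?vs i)])))))"
    by (rule ptime_backbone[OF M ptime_rev[OF ptime_upt[OF n]] ptime_capped_nat[OF n k] ptime_capped_nat[OF n m]])
  then show ?thesis by (simp add: solution_def Let_def case_prod_beta')
qed

section \<open>From indices to nodes\<close>

lemma product_map: "List.product (map f xs) (map g ys) = map (map_prod f g) (List.product xs ys)"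
  by (induction xs) (auto simp: o_def)

lemma filter_map_cong:
  "(\<And>x. x \<in> set xs \<Longrightarrow> P (f x) = Q x) \<Longrightarrow> length (filter P (map f xs)) = length (filter Q xs)"
  by (induction xs) auto

context
  fixes f :: "'a \<Rightarrow> 'b" and xs :: "'a list"
    and adj :: "'b \<Rightarrow> 'b \<Rightarrow> bool" and adj' :: "'a \<Rightarrow> 'a \<Rightarrow> bool"
  assumes inj: "inj_on f (set xs)"
    and adj: "\<And>x y. x \<in> set xs \<Longrightarrow> y \<in> set xs \<Longrightarrow> adj (f x) (f y) = adj' x y"
begin

text \<open>Both adjacency predicates agree on \<open>set xs\<close> only, since matrix lookups out
  of range give a default; greedy lists never leave \<open>set xs\<close>.\<close>

lemma greedy_dom_map: "greedy_dom adj (map f xs) c = map f (greedy_dom adj' xs c)"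
  unfolding greedy_dom_def
  by (rule greedy_map, subst filter_map_cong[where Q = "adj' _"]) (auto simp: adj subset_iff)

text \<open>Besides adjacency the rule compares nodes for equality, which injectivity of
  \<open>f\<close> preserves.\<close>

lemma conn_map:
  assumes uv: "u \<in> set xs" "v \<in> set xs"
  shows "conn adj (map f xs) k (f u) (f v) = map (map_prod f f) (conn adj' xs k u v)"
  unfolding conn_def product_map
proof (rule greedy_map)
  fix H h assume H: "set H \<subseteq> set (List.product xs xs)" and h: "h \<in> set (List.product xs xs)"
  have "length (filter (\<lambda>g. fst g = fst (map_prod f f h)) (map (map_prod f f) H)) = length (filter (\<lambda>g. fst g = fst h) H)"
    by (rule filter_map_cong) (use H h inj in \<open>auto simp: inj_on_def\<close>)
  moreover have "length (filter (\<lambda>g. snd g = snd (map_prod f f h)) (map (map_prod f f) H)) = length (filter (\<lambda>g. snd g = snd h) H)"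
    by (rule filter_map_cong) (use H h inj in \<open>auto simp: inj_on_def\<close>)
  moreover have "fst h \<in> set xs" "snd h \<in> set xs" using h by auto
  ultimately show "(adj (f u) (fst (map_prod f f h)) \<and>
        (fst (map_prod f f h) = snd (map_prod f f h) \<or> adj (fst (map_prod f f h)) (snd (map_prod f f h))) \<and>
        adj (snd (map_prod f f h)) (f v) \<and>
        length (filter (\<lambda>g. fst g = fst (map_prod f f h)) (map (map_prod f f) H)) < k \<and>
        length (filter (\<lambda>g. snd g = snd (map_prod f f h)) (map (map_prod f f) H)) < k \<and>
        length (map (map_prod f f) H) < 2 * k * k) =
       (adj' u (fst h) \<and> (fst h = snd h \<or> adj' (fst h) (snd h)) \<and> adj' (snd h) v \<and>
        length (filter (\<lambda>g. fst g = fst h) H) < k \<and>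
        length (filter (\<lambda>g. snd g = snd h) H) < k \<and> length H < 2 * k * k)"
    using uv inj by (auto simp: adj inj_on_eq_iff)
qed

lemma backbone_map:
  assumes "distinct xs" "w \<in> set xs"
  shows "backbone adj (map f xs) k m (f w) \<longleftrightarrow> backbone adj' xs k m w"
proof -
  have D: "set (greedy_dom adj' xs c) \<subseteq> set xs" for c by (rule greedy_dom_subset)
  have mem: "f w \<in> f ` set (greedy_dom adj' xs c) \<longleftrightarrow> w \<in> set (greedy_dom adj' xs c)" for c
    using inj_on_image_mem_iff[OF inj assms(2) D] .
  have C: "(\<exists>h \<in> set (conn adj (map f xs) k (f u) (f v)). f w = fst h \<or> f w = snd h) \<longleftrightarrow>
      (\<exists>h \<in> set (conn adj' xs k u v). w = fst h \<or> w = snd h)"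
    if "u \<in> set xs" "v \<in> set xs" for u v
    using conn_sound[OF assms(1), of _ adj' k u v] inj_on_eq_iff[OF inj assms(2)]
    by (force simp: conn_map[OF that])
  let ?D = "set (greedy_dom adj' xs k)"
  have "(\<exists>u \<in> f ` ?D. \<exists>v \<in> f ` ?D. \<exists>h \<in> set (conn adj (map f xs) k u v). f w = fst h \<or> f w = snd h) \<longleftrightarrow>
      (\<exists>u \<in> ?D. \<exists>v \<in> ?D. \<exists>h \<in> set (conn adj (map f xs) k (f u) (f v)). f w = fst h \<or> f w = snd h)"
    by (simp only: bex_simps)
  also have "\<dots> \<longleftrightarrow> (\<exists>u \<in> ?D. \<exists>v \<in> ?D. \<exists>h \<in> set (conn adj' xs k u v). w = fst h \<or> w = snd h)"
    by (intro bex_cong refl C) (use D in blast)+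
  finally show ?thesis
    unfolding backbone_def greedy_dom_map set_map mem by (simp only:)
qed

end


section \<open>Induced subgraphs\<close>

lemma induce_induce: "U \<subseteq> S \<Longrightarrow> (H \<restriction> S) \<restriction> U = H \<restriction> U"
  by (auto simp: induce_subgraph_def)

text \<open>Symmetrising adds no arcs to a symmetric graph, and \<open>rtrancl_on U\<close> differs
  from the ordinary closure only in reflexive pairs outside \<open>U\<close>.\<close>

lemma connected_induce:
  assumes "symmetric (with_proj G)"
  shows "Digraph_Component.connected (with_proj G \<restriction> U) \<longleftrightarrow> conn_on (\<lambda>u v. (u, v) \<in> parcs G) U"
proof -
  let ?R = "{(x, y). x \<in> U \<and> y \<in> U \<and> (x, y) \<in> parcs G}"
  have "(y, x) \<in> parcs G" if "(x, y) \<in> parcs G" for x y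
    using assms that by (auto simp: symmetric_def sym_def)
  then have arcs: "parcs (mk_symmetric (with_proj G \<restriction> U)) = ?R"
    by (fastforce simp: mk_symmetric_def)
  have verts: "pverts (mk_symmetric (with_proj G \<restriction> U)) = U" by (simp add: mk_symmetric_def)
  have "(p, q) \<in> rtrancl_on U ?R \<longleftrightarrow> (p, q) \<in> ?R\<^sup>*" if "p \<in> U" "q \<in> U" for p q
    by (rule iffI, erule rtrancl_on_rtranclI, rule rtrancl_consistent_rtrancl_on) (use that in auto)
  then show ?thesis
    by (simp add: connected_def strongly_connected_def reachable_def arcs verts conn_on_def)
qed

lemma k_connected_induce:
  assumes "symmetric (with_proj G)"
  shows "k_connected k (with_proj G \<restriction> S) \<longleftrightarrow>
    (\<forall>X. X \<subseteq> S \<and> finite X \<and> card X < k \<longrightarrow> conn_on (\<lambda>u v. (u, v) \<in> parcs G) (S - X)) \<or>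
    (\<exists>n \<le> k. complete_digraph n (with_proj G \<restriction> S))"
  by (simp add: k_connected_def induce_induce connected_induce[OF assms])

text \<open>Every node outside \<open>T\<close> has at least \<open>m\<close>, hence at least
  \<open>k\<close>, neighbours in \<open>T\<close>, one of which survives the faults; so
  connectivity of \<open>T - X\<close> spreads to all surviving nodes. If \<open>T\<close> is the
  whole node set, the first claim is feasibility itself.\<close>

lemma feasible_whole:
  assumes G: "pair_graph G" and T: "is_km_CDS (with_proj G) k m T" and km: "0 < k" "k \<le> m"
  shows "k_connected k (with_proj G \<restriction> pverts G)"
    and "k < card (pverts G) \<Longrightarrow> X \<subseteq> pverts G \<Longrightarrow> card X < k \<Longrightarrow>
      conn_on (\<lambda>u v. (u, v) \<in> parcs G) (pverts G - X)"
proof -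
  interpret pair_graph G by (rule G)
  let ?V = "pverts G" and ?A = "\<lambda>u v. (u, v) \<in> parcs G"
  have symG: "symmetric (with_proj G)" by (rule pair_sym_arcs)
  have A: "?A y x" if "?A x y" for x y using symG that by (auto simp: symmetric_def sym_def)
  have finV: "finite ?V" by (rule pair_finite_verts)
  have TV: "T \<subseteq> ?V" and Tk: "k_connected k (with_proj G \<restriction> T)"
    and Tm: "\<And>v. v \<in> ?V - T \<Longrightarrow> k \<le> card {u \<in> T. ?A v u}"
    using T km by (force simp: is_km_CDS_def m_dominating_def)+
  have finT: "finite T" using TV finV finite_subset by blast
  have whole: "conn_on ?A (?V - X)"
    if X: "X \<subseteq> ?V" "card X < k" and conn: "conn_on ?A (T - X)" for X
  proof (rule conn_onI)
    show "T - X \<noteq> {}" using conn by (simp add: conn_on_def)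
    show "T - X \<subseteq> ?V - X" using TV by blast
    show "?A y x" if "?A x y" for x y by (rule A) (rule that)
    show "(p, q) \<in> {(x, y). x \<in> ?V - X \<and> y \<in> ?V - X \<and> ?A x y}\<^sup>*" if "p \<in> T - X" "q \<in> T - X" for p q
    proof -
      have "{(x, y). x \<in> T - X \<and> y \<in> T - X \<and> ?A x y}\<^sup>* \<subseteq> {(x, y). x \<in> ?V - X \<and> y \<in> ?V - X \<and> ?A x y}\<^sup>*"
        by (rule rtrancl_mono) (use TV in auto)
      then show ?thesis using conn that unfolding conn_on_def by blast
    qed
    show "\<exists>b\<in>T - X. ?A w b" if "w \<in> ?V - X" "w \<notin> T - X" for w
      using exists_neighbour_outside[OF _ X(2) Tm[of w]] that finite_subset[OF X(1) finV] by auto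
  qed
  have T_conn: "conn_on ?A (T - X)"
    if X: "X \<subseteq> ?V" "card X < k" and big: "T \<noteq> ?V \<or> k < card ?V" for X
    using Tk unfolding k_connected_induce[OF symG]
  proof
    assume *: "\<forall>X. X \<subseteq> T \<and> finite X \<and> card X < k \<longrightarrow> conn_on ?A (T - X)"
    have "card (T \<inter> X) < k"
      using card_mono[of X "T \<inter> X"] X finite_subset[OF X(1) finV] by auto
    then have "conn_on ?A (T - T \<inter> X)" using * finT by auto
    then show ?thesis by (simp add: Diff_Int)
  next
    \<comment> \<open>A complete \<open>T\<close> on at most \<open>k\<close> nodes that dominates
      some outside node has exactly \<open>k\<close> nodes, so \<open>T - X\<close> is a nonempty
      clique.\<close>
    assume "\<exists>n\<le>k. complete_digraph n (with_proj G \<restriction> T)"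
    then have small: "card T \<le> k"
      and "arcs_ends (with_proj G \<restriction> T) = {(u, v). (u, v) \<in> T \<times> T \<and> u \<noteq> v}"
      by (auto simp: complete_digraph_def)
    then have compl: "?A u v" if "u \<in> T" "v \<in> T" "u \<noteq> v" for u v
      using that by (auto simp: arcs_ends_def arc_to_ends_def)
    have "T \<noteq> ?V" using big small by auto
    then obtain w where "w \<in> ?V - T" using TV by blast
    then have "k \<le> card T"
      using Tm[of w] card_mono[OF finT, of "{u \<in> T. ?A w u}"] by force
    then have "\<not> T \<subseteq> X" using X card_mono[OF finite_subset[OF X(1) finV], of T] by linarith
    then show ?thesis
      unfolding conn_on_def using compl by (force intro: r_into_rtrancl)
  qed
  show "k_connected k (with_proj G \<restriction> ?V)"
  proof (cases "T = ?V")
    case False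
    then show ?thesis unfolding k_connected_induce[OF symG] using whole T_conn by blast
  qed (use Tk in simp)
  show "conn_on ?A (?V - X)" if "k < card ?V" "X \<subseteq> ?V" "card X < k"
    using whole T_conn that by blast
qed

lemma square_le_power5: "k\<^sup>2 \<le> (5::nat) ^ k"
proof (induction k)
  case (Suc k)
  have "(Suc k)\<^sup>2 \<le> 5 * k\<^sup>2" if "0 < k"
    using that by (cases k) (auto simp: power2_eq_square algebra_simps)
  then show ?case using Suc by (cases "k = 0") force+
qed simp


section \<open>Correctness and size of the computed set\<close>

lemma adjm_adj_matrix:
  "a < length vs \<Longrightarrow> b < length vs \<Longrightarrow> adjm (adj_matrix vs G) a b \<longleftrightarrow> (vs ! a, vs ! b) \<in> parcs G"
  by (simp add: adjm_def adj_matrix_def nth_default_nth)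

lemma enc_solution:
  fixes vs :: "'a list" and G k m
  assumes vs: "distinct vs"
  defines "n \<equiv> length vs"
  shows "enc_list (map enc_bool (solution vs G k m)) =
    enc_set vs {w \<in> set vs. backbone (\<lambda>u v. (u, v) \<in> parcs G) (rev vs) (min n k) (min n m) w}"
proof -
  have "backbone (adjm (adj_matrix vs G)) (rev [0..<n]) (min n k) (min n m) i \<longleftrightarrow>
      backbone (\<lambda>u v. (u, v) \<in> parcs G) (rev vs) (min n k) (min n m) (vs ! i)" if "i < n" for i
  proof -
    have map: "map ((!) vs) (rev [0..<n]) = rev vs"
      by (simp add: n_def map_nth flip: rev_map)
    have "inj_on ((!) vs) (set (rev [0..<n]))" using vs by (simp add: n_def inj_on_nth)
    from backbone_map[OF this, of "\<lambda>u v. (u, v) \<in> parcs G" "adjm (adj_matrix vs G)" i "min n k" "min n m", unfolded map]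
    show ?thesis using that by (simp add: n_def adjm_adj_matrix)
  qed
  then have "solution vs G k m =
      map (backbone (\<lambda>u v. (u, v) \<in> parcs G) (rev vs) (min n k) (min n m)) (map ((!) vs) [0..<n])"
    by (simp add: solution_def Let_def flip: n_def)
  also have "map ((!) vs) [0..<n] = vs" by (simp add: n_def map_nth)
  finally show ?thesis
    unfolding enc_set_def by (intro arg_cong[where f = enc_list]) simp
qed

text \<open>
  The degree of a node bounds every count in the algorithm, so capping the parameters at the
  number of nodes does not weaken the requirements.
\<close>

lemma greedy_dom_dominating_capped:
  assumes vs: "distinct vs" and irrefl: "\<not> adj v v"
    and v: "v \<in> set vs" "v \<notin> set (greedy_dom adj vs (min (length vs) c))"
  shows "c < length vs \<and> c \<le> card {u \<in> set (greedy_dom adj vs (min (length vs) c)). adj v u}"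
proof -
  let ?N = "{u \<in> set (greedy_dom adj vs (min (length vs) c)). adj v u}"
  have "?N \<subseteq> set vs - {v}"
    using greedy_dom_subset[of adj vs] irrefl by auto
  then have "card ?N < length vs"
    using card_mono[of "set vs - {v}" ?N] v(1) distinct_card[OF vs] card_Diff1_less[of "set vs" v] by simp
  then show ?thesis using greedy_dom_dominating[OF vs v] by auto
qed

text \<open>If the greedy set for \<open>k\<close> is everything, so is \<open>S\<close>, and small
  complete graphs are covered by the feasibility of the whole node set. Otherwise some node was
  rejected, which forces \<open>k < n\<close>: the cap on \<open>k\<close> has no effect and the
  rerouting argument applies.\<close>

lemma backbone_is_km_CDS:
  fixes G :: "'a pair_pre_digraph" and vs :: "'a list"
  assumes G: "pair_graph G" and vs: "distinct vs" "set vs = pverts G"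
    and km: "0 < k" "k \<le> m" and T: "is_km_CDS (with_proj G) k m T"
  defines "n \<equiv> length vs"
  defines "S \<equiv> {w \<in> set vs. backbone (\<lambda>u v. (u, v) \<in> parcs G) vs (min n k) (min n m) w}"
  shows "is_km_CDS (with_proj G) k m S"
  unfolding is_km_CDS_def
proof (intro conjI)
  interpret pair_graph G by (rule G)
  let ?V = "pverts G" and ?A = "\<lambda>u v. (u, v) \<in> parcs G"
  have symG: "symmetric (with_proj G)" by (rule pair_sym_arcs)
  have irrefl: "\<not> ?A v v" for v using pair_no_loops by force
  have D: "set (greedy_dom ?A vs (min n k)) \<subseteq> S" "set (greedy_dom ?A vs (min n m)) \<subseteq> S"
    using greedy_dom_subset[of ?A vs] by (auto simp: S_def backbone_def)
  show "S \<subseteq> verts (with_proj G)" using vs by (auto simp: S_def)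
  show "m_dominating m (with_proj G) S"
    unfolding m_dominating_def
  proof
    fix v assume "v \<in> verts (with_proj G) - S"
    then have "m \<le> card {u \<in> set (greedy_dom ?A vs (min n m)). ?A v u}"
      using greedy_dom_dominating_capped[of vs ?A v m] vs irrefl D(2) by (auto simp: n_def)
    also have "\<dots> \<le> card {u \<in> S. ?A v u}"
      using D(2) by (intro card_mono) (auto simp: S_def)
    finally show "m \<le> card {u \<in> S. v \<rightarrow>\<^bsub>with_proj G\<^esub> u}" by simp
  qed
  show "k_connected k (with_proj G \<restriction> S)"
  proof (cases "set (greedy_dom ?A vs (min n k)) = ?V")
    case True
    then have "S = ?V" using D vs by (auto simp: S_def)
    then show ?thesis using feasible_whole(1)[OF G T km] by simp
  next
    case False
    then obtain v where "v \<in> ?V" "v \<notin> set (greedy_dom ?A vs (min n k))"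
      using greedy_dom_subset[of ?A vs] vs by blast
    then have kn: "k < n"
      using greedy_dom_dominating_capped[of vs ?A v k] vs irrefl by (auto simp: n_def)
    then have n: "min n k = k" "k < card ?V"
      using distinct_card[OF vs(1)] vs(2) by (auto simp: n_def)
    have "conn_on ?A (S - X)" if X: "X \<subseteq> S" "finite X" "card X < k" for X
    proof -
      have XV: "X \<subseteq> ?V" using X vs by (auto simp: S_def)
      show ?thesis unfolding S_def n(1)
      proof (rule backbone_connected[OF vs(1) X(2,3)])
        show "conn_on ?A (set vs - X)"
          using feasible_whole(2)[OF G T km n(2) XV X(3)] vs by simp
        show "?A y x" if "?A x y" for x y
          using symG that by (auto simp: symmetric_def sym_def)
        show "set (greedy_dom ?A vs k) \<noteq> set vs" using False n vs by simp
      qed (use XV vs in simp)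
    qed
    then show ?thesis unfolding k_connected_induce[OF symG] by blast
  qed
qed

text \<open>Both greedy sets have at most 26 times the size of \<open>T\<close>, because
  \<open>T\<close> also dominates for the smaller capped parameters. The empty graph is separate,
  since its capped parameters vanish. The constant is
  \<open>17628 = 2 * 26 + 26 * 676\<close>.\<close>

lemma (in unit_disk) card_backbone_bound:
  assumes T: "T \<subseteq> set vs" and dom: "\<And>v. v \<in> set vs \<Longrightarrow> v \<notin> T \<Longrightarrow> m \<le> card {u \<in> T. adj v u}"
    and km: "0 < k" "k \<le> m"
  defines "n \<equiv> length vs"
  shows "card {w \<in> set vs. backbone adj vs (min n k) (min n m) w} \<le> 17628 * k * 5 ^ k * card T"
proof (cases "n = 0")
  case False
  let ?D = "set (greedy_dom adj vs (min n k))" and ?M = "set (greedy_dom adj vs (min n m))"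
  have D: "card ?D \<le> 26 * card T"
    by (rule card_greedy_dom[OF T]) (use False km in \<open>auto dest!: dom intro: le_trans\<close>)
  have M: "card ?M \<le> 26 * card T"
    by (rule card_greedy_dom[OF T]) (use False km in \<open>auto dest!: dom intro: le_trans\<close>)
  have "(min n k) ^ 3 \<le> k ^ 3" by (intro power_mono) auto
  also have "\<dots> \<le> k * 5 ^ k"
    using square_le_power5[of k] by (simp add: power3_eq_cube power2_eq_square)
  finally have k3: "(min n k) ^ 3 \<le> k * 5 ^ k" .
  have one: "1 \<le> k * 5 ^ k" using km by simp
  have "card {w \<in> set vs. backbone adj vs (min n k) (min n m) w} \<le> card ?M + card ?D * (1 + 676 * (min n k) ^ 3)"
    by (rule card_backbone)
  also have "\<dots> \<le> 26 * card T + 26 * card T * (1 + 676 * (k * 5 ^ k))"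
    using k3 by (intro add_mono mult_mono M D) auto
  also have "\<dots> = card T * (52 + 17576 * (k * 5 ^ k))" by (simp add: algebra_simps)
  also have "\<dots> \<le> card T * (17628 * (k * 5 ^ k))" using one by (intro mult_left_mono) linarith+
  finally show ?thesis by (simp add: ac_simps)
qed (simp add: n_def)

text \<open>The program for base 0 tolerates arbitrary contents of its scratch variables, in
  particular the initial \<open>Leaf\<close>.\<close>

lemma ptime_computes:
  assumes "ptime e g"
  obtains P and q :: "nat poly" where "\<And>i. \<exists>t. computes P (e i) (g i) t \<and> t \<le> poly q (tsize (e i))"
proof -
  obtain q :: "nat poly" where "\<And>n. \<exists>P. \<forall>i. runs P n (e i) (g i) (poly q (tsize (e i)))"
    using assms by (rule ptimeE) blast
  then obtain P where "\<And>i. runs P 0 (e i) (g i) (poly q (tsize (e i)))" by blast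
  from runsD[OF this, of "(\<lambda>_. Leaf)(0 := e i)" for i]
  have "\<exists>t. computes P (e i) (g i) t \<and> t \<le> poly q (tsize (e i))" for i
    unfolding computes_def by (metis fun_upd_same)
  then show thesis by (rule that)
qed

theorem corollary1:
  shows "\<exists>(C :: real) (P :: com) (q :: nat poly).
    \<forall>(G :: nat pair_pre_digraph) (vs :: nat list) (k :: nat) (m :: nat).
      unit_disk_graph G \<and> distinct vs \<and> set vs = pverts G \<and>
      0 < k \<and> k \<le> m \<and> (\<exists>S. is_km_CDS (with_proj G) k m S) \<longrightarrow>
      (\<exists>S t. computes P (enc_instance vs G k m) (enc_set vs S) t \<and>
         t \<le> poly q (tsize (enc_instance vs G k m)) \<and>
         is_km_CDS (with_proj G) k m S \<and>
         real (card S) \<le> C * real k * 5 ^ k * real (opt_km_CDS (with_proj G) k m))"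
proof -
  obtain P and q :: "nat poly" where "\<And>i :: nat pair_pre_digraph \<times> nat list \<times> nat \<times> nat.
      \<exists>t. computes P ((\<lambda>(G, vs, k, m). enc_instance vs G k m) i)
          ((\<lambda>(G, vs, k, m). enc_list (map enc_bool (solution vs G k m))) i) t \<and>
        t \<le> poly q (tsize ((\<lambda>(G, vs, k, m). enc_instance vs G k m) i))"
    using ptime_solution by (rule ptime_computes) blast
  then have P: "\<exists>t. computes P (enc_instance vs G k m) (enc_list (map enc_bool (solution vs G k m))) t \<and>
        t \<le> poly q (tsize (enc_instance vs G k m))" for G :: "nat pair_pre_digraph" and vs k m
    by (simp add: split_paired_all)
  show ?thesis
  proof (intro exI[of _ "17628::real"] exI[of _ P] exI[of _ q] allI impI, elim conjE exE)
    fix G :: "nat pair_pre_digraph" and vs :: "nat list" and k m :: nat and T0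
    assume udg: "unit_disk_graph G" and vs: "distinct vs" "set vs = pverts G"
      and km: "0 < k" "k \<le> m" and T0: "is_km_CDS (with_proj G) k m T0"
    let ?A = "\<lambda>u v. (u, v) \<in> parcs G" and ?n = "length vs"
    define S where "S = {w \<in> set vs. backbone ?A (rev vs) (min ?n k) (min ?n m) w}"
    have G: "pair_graph G" using udg by (simp add: unit_disk_graph_def)
    interpret pair_graph G by (rule G)
    obtain pos :: "nat \<Rightarrow> real ^ 2" where pos: "\<forall>u \<in> pverts G. \<forall>v \<in> pverts G.
        u \<noteq> v \<longrightarrow> ((u, v) \<in> parcs G \<longleftrightarrow> dist (pos u) (pos v) \<le> 1)"
      using udg by (auto simp: unit_disk_graph_def)
    \<comment> \<open>The reversed enumeration is the order in which the program scans the nodes;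
      the size bound holds for every enumeration.\<close>
    interpret disk: unit_disk "rev vs" ?A pos
      by unfold_locales (use vs pos pair_no_loops in force)+
    obtain t where t: "computes P (enc_instance vs G k m) (enc_set vs S) t"
        "t \<le> poly q (tsize (enc_instance vs G k m))"
      using P[of vs G k m] unfolding enc_solution[OF vs(1)] S_def by blast
    have feasible: "is_km_CDS (with_proj G) k m S"
      using backbone_is_km_CDS[OF G, of "rev vs", OF _ _ km T0] vs by (simp add: S_def)
    have "finite {S. is_km_CDS (with_proj G) k m S}"
      by (rule finite_subset[of _ "Pow (pverts G)"]) (auto simp: is_km_CDS_def pair_finite_verts)
    then have "opt_km_CDS (with_proj G) k m \<in> card ` {S. is_km_CDS (with_proj G) k m S}"
      unfolding opt_km_CDS_def using T0 by (intro Min_in) auto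
    then obtain T where T: "is_km_CDS (with_proj G) k m T" "opt_km_CDS (with_proj G) k m = card T"
      by blast
    have "card S \<le> 17628 * k * 5 ^ k * card T"
      using disk.card_backbone_bound[of T m k] T(1) km vs
      by (simp add: S_def is_km_CDS_def m_dominating_def)
    then have "real (card S) \<le> real (17628 * k * 5 ^ k * card T)" by (simp only: of_nat_le_iff)
    then have "real (card S) \<le> 17628 * real k * 5 ^ k * real (opt_km_CDS (with_proj G) k m)"
      by (simp add: T(2))
    then show "\<exists>S t. computes P (enc_instance vs G k m) (enc_set vs S) t \<and>
         t \<le> poly q (tsize (enc_instance vs G k m)) \<and> is_km_CDS (with_proj G) k m S \<and>
         real (card S) \<le> 17628 * real k * 5 ^ k * real (opt_km_CDS (with_proj G) k m)"
      using t feasible by blast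
  qed
qed

end
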